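(* Let $X,Y$ be arbitrary $n\times n$ quaternionic matrices. Then $$\|[X,Y]\|^2\le 4\|X\|^2\|Y\|^2 .$$ Equality holds if and only if either $\|X\|\|Y\|=0$ or there exists a unitary matrix $U\in U(2n)$ such that $\Psi(X)=U^*\mathrm{diag}(X_0,0)U$ and $\Psi(Y)=U^*\mathrm{diag}(Y_0,0)U$, where $X_0,Y_0\in M(2,\mathbb{C})$ satisfy $\langle X_0,Y_0\rangle=0$, $\mathrm{tr}(X_0)=\mathrm{tr}(Y_0)=0$, and $\mathrm{rank}\,X_0=\mathrm{rank}\,Y_0=2$.
   Context: $\mathbb{H}$ denotes the quaternions with canonical basis $1,\mathbf{i},\mathbf{j},\mathbf{k}$, and $M(n,\mathbb{H})$ the $n\times n$ quaternionic matrices; $[X,Y]=XY-YX$; for $X=(x_{ij})$ real, complex or quaternionic, $\|X\|^2=\sum_{i,j}|x_{ij}|^2$ is the squared Frobenius norm. On complex matrices, $\langle A,B\rangle=\mathrm{tr}(AB^* )$ with $B^*=\overline{B}^t$. $\mathrm{diag}(X_0,0)$ denotes the $2n\times 2n$ block diagonal matrix with upper-left block $X_0$ and all other entries zero (the zero block may be empty). The map $\Psi:M(n,\mathbb{H})\to M(2n,\mathbb{C})$ is defined, for $X=X_1+X_2\mathbf{j}$ with $X_1,X_2\in M(n,\mathbb{C})$ (where $\mathbb{C}=\mathbb{R}+\mathbb{R}\mathbf{i}\subset\mathbb{H}$), by $$\Psi(X)=\begin{pmatrix}X_1&X_2\\-\overline{X_2}&\overline{X_1}\end{pmatrix}.$$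 *)

theory Defs
  imports
    Complex_Main
    "Jordan_Normal_Form.Schur_Decomposition"
    "Jordan_Normal_Form.DL_Rank"
begin

section \<open>Quaternions\<close>

datatype quat = Quat (qRe: real) (qI: real) (qJ: real) (qK: real)

lemma quat_eq_iff:
  "p = q \<longleftrightarrow> qRe p = qRe q \<and> qI p = qI q \<and> qJ p = qJ q \<and> qK p = qK q"
  by (cases p; cases q) auto

instantiation quat :: ring_1
begin

definition zero_quat :: quat where "0 = Quat 0 0 0 0"

definition one_quat :: quat where "1 = Quat 1 0 0 0"

definition plus_quat :: "quat \<Rightarrow> quat \<Rightarrow> quat" where
  "p + q = Quat (qRe p + qRe q) (qI p + qI q) (qJ p + qJ q) (qK p + qK q)"

definition minus_quat :: "quat \<Rightarrow> quat \<Rightarrow> quat" where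
  "p - q = Quat (qRe p - qRe q) (qI p - qI q) (qJ p - qJ q) (qK p - qK q)"

definition uminus_quat :: "quat \<Rightarrow> quat" where
  "- p = Quat (- qRe p) (- qI p) (- qJ p) (- qK p)"

definition times_quat :: "quat \<Rightarrow> quat \<Rightarrow> quat" where
  "p * q = Quat
     (qRe p * qRe q - qI p * qI q - qJ p * qJ q - qK p * qK q)
     (qRe p * qI q + qI p * qRe q + qJ p * qK q - qK p * qJ q)
     (qRe p * qJ q - qI p * qK q + qJ p * qRe q + qK p * qI q)
     (qRe p * qK q + qI p * qJ q - qJ p * qI q + qK p * qRe q)"

instance
  by standard
    (simp_all add: quat_eq_iff zero_quat_def one_quat_def plus_quat_def minus_quat_def
      uminus_quat_def times_quat_def algebra_simps)

end

instantiation quat :: real_algebra_1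
begin

definition scaleR_quat :: "real \<Rightarrow> quat \<Rightarrow> quat" where
  "r *\<^sub>R q = Quat (r * qRe q) (r * qI q) (r * qJ q) (r * qK q)"

instance
  by standard
    (simp_all add: quat_eq_iff scaleR_quat_def plus_quat_def times_quat_def algebra_simps)

end

lemma quat_sel_simps [simp]:
  "qRe 0 = 0" "qI 0 = 0" "qJ 0 = 0" "qK 0 = 0"
  "qRe 1 = 1" "qI 1 = 0" "qJ 1 = 0" "qK 1 = 0"
  "qRe (p + q) = qRe p + qRe q" "qI (p + q) = qI p + qI q"
  "qJ (p + q) = qJ p + qJ q" "qK (p + q) = qK p + qK q"
  "qRe (p - q) = qRe p - qRe q" "qI (p - q) = qI p - qI q"
  "qJ (p - q) = qJ p - qJ q" "qK (p - q) = qK p - qK q"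
  "qRe (- p) = - qRe p" "qI (- p) = - qI p" "qJ (- p) = - qJ p" "qK (- p) = - qK p"
  "qRe (r *\<^sub>R p) = r * qRe p" "qI (r *\<^sub>R p) = r * qI p"
  "qJ (r *\<^sub>R p) = r * qJ p" "qK (r *\<^sub>R p) = r * qK p"
  by (simp_all add: zero_quat_def one_quat_def plus_quat_def minus_quat_def uminus_quat_def
      scaleR_quat_def)

instantiation quat :: real_normed_algebra_1
begin

definition norm_quat :: "quat \<Rightarrow> real" where
  "norm_quat q = sqrt ((qRe q)\<^sup>2 + (qI q)\<^sup>2 + (qJ q)\<^sup>2 + (qK q)\<^sup>2)"

definition sgn_quat :: "quat \<Rightarrow> quat" where
  "sgn_quat q = q /\<^sub>R norm q"

definition dist_quat :: "quat \<Rightarrow> quat \<Rightarrow> real" where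
  "dist_quat p q = norm (p - q)"

definition uniformity_quat :: "(quat \<times> quat) filter" where
  "uniformity_quat = (INF e\<in>{0 <..}. principal {(x :: quat, y). dist x y < e})"

definition open_quat :: "quat set \<Rightarrow> bool" where
  "open_quat U \<longleftrightarrow> (\<forall>x\<in>U. eventually (\<lambda>(x', y). x' = x \<longrightarrow> y \<in> U) uniformity)"

instance
proof
  fix p q :: quat and r :: real
  show "norm q = 0 \<longleftrightarrow> q = 0"
    by (simp add: norm_quat_def quat_eq_iff add_nonneg_eq_0_iff)
  show "norm (r *\<^sub>R q) = \<bar>r\<bar> * norm q"
    by (simp add: norm_quat_def power_mult_distrib real_sqrt_mult flip: distrib_left)
  have eq_mult: "norm (p * q) = norm p * norm q"
    unfolding norm_quat_def real_sqrt_mult[symmetric]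
    by (rule arg_cong[where f = sqrt]) (simp add: times_quat_def power2_eq_square algebra_simps)
  show "norm (p * q) \<le> norm p * norm q"
    using eq_mult by simp
  show "norm (1 :: quat) = 1"
    by (simp add: norm_quat_def)
  define A where "A x = norm (Complex (qRe x) (qI x))" for x
  define B where "B x = norm (Complex (qJ x) (qK x))" for x
  have norm_AB: "norm x = sqrt ((A x)\<^sup>2 + (B x)\<^sup>2)" for x :: quat
    by (simp add: norm_quat_def A_def B_def cmod_def add.assoc)
  have "A (p + q) \<le> A p + A q" "B (p + q) \<le> B p + B q"
    using norm_triangle_ineq[of "Complex (qRe p) (qI p)" "Complex (qRe q) (qI q)"]
      norm_triangle_ineq[of "Complex (qJ p) (qK p)" "Complex (qJ q) (qK q)"]
    by (simp_all add: A_def B_def flip: complex_add)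
  moreover have "0 \<le> A (p + q)" "0 \<le> B (p + q)"
    by (simp_all add: A_def B_def flip: complex_add)
  ultimately have "norm (p + q) \<le> sqrt ((A p + A q)\<^sup>2 + (B p + B q)\<^sup>2)"
    unfolding norm_AB by (intro real_sqrt_le_mono add_mono power_mono)
  also have "\<dots> \<le> norm p + norm q"
    unfolding norm_AB by (rule real_sqrt_sum_squares_triangle_ineq)
  finally show "norm (p + q) \<le> norm p + norm q" .
qed (rule sgn_quat_def dist_quat_def uniformity_quat_def open_quat_def)+

end

definition quat_i :: quat where "quat_i = Quat 0 1 0 0"
definition quat_j :: quat where "quat_j = Quat 0 0 1 0"
definition quat_k :: quat where "quat_k = Quat 0 0 0 1"

lemma quat_units:
  "quat_i * quat_i = - 1" "quat_j * quat_j = - 1" "quat_k * quat_k = - 1"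
  "quat_i * quat_j = quat_k" "quat_j * quat_k = quat_i" "quat_k * quat_i = quat_j"
  "quat_j * quat_i = - quat_k" "quat_k * quat_j = - quat_i" "quat_i * quat_k = - quat_j"
  by (simp_all add: quat_eq_iff quat_i_def quat_j_def quat_k_def times_quat_def)

lemma quat_basis:
  "Quat a b c d = a *\<^sub>R 1 + b *\<^sub>R quat_i + c *\<^sub>R quat_j + d *\<^sub>R quat_k"
  by (simp add: quat_eq_iff quat_i_def quat_j_def quat_k_def)

definition quat_of_complex :: "complex \<Rightarrow> quat" where
  "quat_of_complex z = Re z *\<^sub>R 1 + Im z *\<^sub>R quat_i"

text \<open>The complex coordinates $q_1, q_2$ of $q = q_1 + q_2 \mathbf{j}$.\<close>

definition cpart1 :: "quat \<Rightarrow> complex" where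
  "cpart1 q = Complex (qRe q) (qI q)"

definition cpart2 :: "quat \<Rightarrow> complex" where
  "cpart2 q = Complex (qJ q) (qK q)"

lemma quat_complex_decomp:
  "q = quat_of_complex z + quat_of_complex w * quat_j \<longleftrightarrow> z = cpart1 q \<and> w = cpart2 q"
  by (auto simp: quat_eq_iff quat_of_complex_def quat_i_def quat_j_def times_quat_def
      cpart1_def cpart2_def complex_eq_iff)


section \<open>Matrices\<close>

definition frob_norm :: "'a::real_normed_vector mat \<Rightarrow> real" where
  "frob_norm X = sqrt (\<Sum>i<dim_row X. \<Sum>j<dim_col X. (norm (X $$ (i, j)))\<^sup>2)"

definition commutator :: "'a::ring mat \<Rightarrow> 'a mat \<Rightarrow> 'a mat" where
  "commutator X Y = X * Y - Y * X"

definition Psi :: "quat mat \<Rightarrow> complex mat" where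
  "Psi X = (let X1 = map_mat cpart1 X; X2 = map_mat cpart2 X in
     four_block_mat X1 X2 (- map_mat cnj X2) (map_mat cnj X1))"

lemma Psi_eq:
  assumes "X1 \<in> carrier_mat n n" "X2 \<in> carrier_mat n n"
    and "X = map_mat quat_of_complex X1 + map_mat (\<lambda>z. quat_of_complex z * quat_j) X2"
  shows "Psi X = four_block_mat X1 X2 (- map_mat cnj X2) (map_mat cnj X1)"
proof -
  have *: "cpart1 (quat_of_complex z + quat_of_complex w * quat_j) = z"
    "cpart2 (quat_of_complex z + quat_of_complex w * quat_j) = w" for z w
    using quat_complex_decomp[THEN iffD1, OF refl] by simp_all
  have "map_mat cpart1 X = X1" "map_mat cpart2 X = X2"
    using assms by (auto intro!: eq_matI simp: *)
  then show ?thesis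
    by (simp add: Psi_def)
qed

definition mat_trace :: "'a::comm_monoid_add mat \<Rightarrow> 'a" where
  "mat_trace A = (\<Sum>i<dim_row A. A $$ (i, i))"

definition mat_inner :: "complex mat \<Rightarrow> complex mat \<Rightarrow> complex" where
  "mat_inner A B = mat_trace (A * mat_adjoint B)"

definition unitary_mat :: "nat \<Rightarrow> complex mat \<Rightarrow> bool" where
  "unitary_mat m U \<longleftrightarrow>
     U \<in> carrier_mat m m \<and> mat_adjoint U * U = 1\<^sub>m m \<and> U * mat_adjoint U = 1\<^sub>m m"

text \<open>\<open>diag_zero m A\<close> is diag(A, 0) of size m, for A square of size at most m.\<close>

definition diag_zero :: "nat \<Rightarrow> 'a::zero mat \<Rightarrow> 'a mat" where
  "diag_zero m A = (let r = dim_row A in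
     four_block_mat A (0\<^sub>m r (m - r)) (0\<^sub>m (m - r) r) (0\<^sub>m (m - r) (m - r)))"

end

theory Submission
  imports Defs "Jordan_Normal_Form.Spectral_Radius"
begin

text \<open>
  \<open>Psi\<close> is multiplicative and doubles squared norms, so the bound is the Boettcher-Wenzel inequality
  \<open>|[X,Y]|^2 \<le> 2 |X|^2 |Y|^2\<close> for complex matrices. Since
  \<open>\<langle>XY, YX\<rangle>\<close> is the conjugate of \<open>\<langle>X*Y, YX*\<rangle>\<close>, the four products satisfy
  \<open>|[X,Y]|^2 + |X*Y + YX*|^2 = |XY|^2 + |YX|^2 + |X*Y|^2 + |YX*|^2\<close>. Writing
  \<open>X = A + iB\<close> with hermitian parts, the right-hand side is
  \<open>2 (|AY|^2 + |YA|^2 + |BY|^2 + |YB|^2)\<close>, while the left commutator does not change when real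
  scalars are subtracted from \<open>A\<close> and \<open>B\<close>. In an eigenbasis of \<open>A\<close>, \<open>|AY|^2 + |YA|^2\<close> is the second
  moment of the spectrum under weights \<open>p_i\<close> of total mass \<open>2 |Y|^2\<close>; centring it gives a variance,
  which is at most \<open>|A|^2 |Y|^2\<close>. Equality forces spectrum \<open>t, -t, 0, \<dots>\<close> and weights concentrated on the
  first two eigenvectors, so the kernel of each nonzero hermitian part of \<open>X\<close> is annihilated by \<open>Y\<close> and
  \<open>Y*\<close>; exchanging \<open>X\<close> and \<open>Y\<close> yields a common two-dimensional block. The traces
  vanish by the shape of the spectra, and orthogonality comes from the Lagrange identity. The rank is \<open>2\<close> because a block of
  rank one would make all two-by-two minors of \<open>Psi X\<close> vanish, yet among them are the
  \<open>|x_ij|^2\<close>.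
\<close>

section \<open>The Frobenius inner product\<close>

lemma mat_adjoint_dim [simp]:
  "dim_row (mat_adjoint A) = dim_col A" "dim_col (mat_adjoint A) = dim_row A"
  by (auto simp: mat_adjoint_def)

lemma mat_adjoint_index [simp]:
  fixes A :: "complex mat"
  shows "i < dim_col A \<Longrightarrow> j < dim_row A \<Longrightarrow> mat_adjoint A $$ (i, j) = cnj (A $$ (j, i))"
  by (auto simp: mat_adjoint_def mat_of_rows_def)

lemma mat_adjoint_carrier [simp]: "A \<in> carrier_mat n m \<Longrightarrow> mat_adjoint A \<in> carrier_mat m n"
  by auto

lemma mat_adjoint_adjoint [simp]: "mat_adjoint (mat_adjoint A) = (A :: complex mat)"
  by (rule eq_matI) auto

lemma mat_adjoint_mult:
  fixes A B :: "complex mat"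
  assumes "A \<in> carrier_mat n k" "B \<in> carrier_mat k m"
  shows "mat_adjoint (A * B) = mat_adjoint B * mat_adjoint A"
  using assms by (intro eq_matI) (auto simp: scalar_prod_def mult.commute)

lemma mat_adjoint_add:
  fixes A B :: "complex mat"
  assumes "A \<in> carrier_mat n m" "B \<in> carrier_mat n m"
  shows "mat_adjoint (A + B) = mat_adjoint A + mat_adjoint B"
  using assms by (intro eq_matI) auto

lemma mat_adjoint_minus:
  fixes A B :: "complex mat"
  assumes "A \<in> carrier_mat n m" "B \<in> carrier_mat n m"
  shows "mat_adjoint (A - B) = mat_adjoint A - mat_adjoint B"
  using assms by (intro eq_matI) auto

lemma mat_adjoint_smult: "mat_adjoint (c \<cdot>\<^sub>m A) = cnj c \<cdot>\<^sub>m mat_adjoint (A :: complex mat)"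
  by (intro eq_matI) auto

lemma mat_mult_index:
  "A \<in> carrier_mat n k \<Longrightarrow> B \<in> carrier_mat k m \<Longrightarrow> i < n \<Longrightarrow> j < m \<Longrightarrow>
    (A * B) $$ (i, j) = (\<Sum>l<k. A $$ (i, l) * B $$ (l, j))"
  by (auto simp: scalar_prod_def lessThan_atLeast0)

lemma mult_square_carrier [simp]:
  "A \<in> carrier_mat m m \<Longrightarrow> B \<in> carrier_mat m m \<Longrightarrow> A * B \<in> carrier_mat m m"
  by auto

lemma minus_square_carrier [simp]:
  "A \<in> carrier_mat m m \<Longrightarrow> B \<in> carrier_mat m m \<Longrightarrow> A - B \<in> carrier_mat m m"
  by (rule minus_carrier_mat)

lemma frob_norm_sq:
  "X \<in> carrier_mat n m \<Longrightarrow> (frob_norm X)\<^sup>2 = (\<Sum>i<n. \<Sum>j<m. (norm (X $$ (i, j)))\<^sup>2)"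
  by (auto simp: frob_norm_def sum_nonneg)

lemma frob_norm_nonneg: "0 \<le> frob_norm X"
  by (simp add: frob_norm_def sum_nonneg)

lemma frob_norm_eq_0:
  assumes "X \<in> carrier_mat n m"
  shows "frob_norm X = 0 \<longleftrightarrow> X = 0\<^sub>m n m"
proof -
  have "frob_norm X = 0 \<longleftrightarrow> (frob_norm X)\<^sup>2 = 0"
    by simp
  also have "\<dots> \<longleftrightarrow> (\<forall>i<n. \<forall>j<m. X $$ (i, j) = 0)"
    by (simp add: frob_norm_sq[OF assms] sum_nonneg_eq_0_iff sum_nonneg) auto
  also have "\<dots> \<longleftrightarrow> X = 0\<^sub>m n m"
    using assms by (auto intro!: eq_matI)
  finally show ?thesis .
qed

lemma mat_inner_sum:
  assumes "A \<in> carrier_mat n m" "B \<in> carrier_mat n m"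
  shows "mat_inner A B = (\<Sum>i<n. \<Sum>j<m. A $$ (i, j) * cnj (B $$ (i, j)))"
  using assms by (auto simp: mat_inner_def mat_trace_def scalar_prod_def lessThan_atLeast0)

lemma mat_inner_self:
  assumes "A \<in> carrier_mat n m"
  shows "mat_inner A A = complex_of_real ((frob_norm A)\<^sup>2)"
  by (simp add: mat_inner_sum[OF assms assms] frob_norm_sq[OF assms] complex_norm_square
      del: of_real_power)

lemma frob_norm_inner:
  "A \<in> carrier_mat n m \<Longrightarrow> (frob_norm A)\<^sup>2 = Re (mat_inner A A)"
  by (simp add: mat_inner_self)

lemma mat_inner_commute:
  assumes "A \<in> carrier_mat n m" "B \<in> carrier_mat n m"
  shows "mat_inner A B = cnj (mat_inner B A)"
  by (simp add: mat_inner_sum[OF assms] mat_inner_sum[OF assms(2,1)] mult.commute)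

lemma mat_inner_add_left:
  assumes "A \<in> carrier_mat n m" "B \<in> carrier_mat n m" "C \<in> carrier_mat n m"
  shows "mat_inner (A + B) C = mat_inner A C + mat_inner B C"
  using assms by (simp add: mat_inner_sum[where n = n and m = m] algebra_simps sum.distrib)

lemma mat_inner_minus_left:
  assumes "A \<in> carrier_mat n m" "B \<in> carrier_mat n m" "C \<in> carrier_mat n m"
  shows "mat_inner (A - B) C = mat_inner A C - mat_inner B C"
  using assms by (simp add: mat_inner_sum[where n = n and m = m] minus_carrier_mat algebra_simps sum_subtractf)

lemma mat_inner_smult_left:
  assumes "A \<in> carrier_mat n m" "C \<in> carrier_mat n m"
  shows "mat_inner (c \<cdot>\<^sub>m A) C = c * mat_inner A C"
  using assms by (simp add: mat_inner_sum[where n = n and m = m] sum_distrib_left mult.assoc)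

lemma mat_inner_add_right:
  assumes "A \<in> carrier_mat n m" "B \<in> carrier_mat n m" "C \<in> carrier_mat n m"
  shows "mat_inner C (A + B) = mat_inner C A + mat_inner C B"
  using assms by (simp add: mat_inner_sum[where n = n and m = m] algebra_simps sum.distrib)

lemma mat_inner_minus_right:
  assumes "A \<in> carrier_mat n m" "B \<in> carrier_mat n m" "C \<in> carrier_mat n m"
  shows "mat_inner C (A - B) = mat_inner C A - mat_inner C B"
  using assms by (simp add: mat_inner_sum[where n = n and m = m] minus_carrier_mat algebra_simps sum_subtractf)

lemma mat_inner_smult_right:
  assumes "A \<in> carrier_mat n m" "C \<in> carrier_mat n m"
  shows "mat_inner C (c \<cdot>\<^sub>m A) = cnj c * mat_inner C A"
  using assms by (simp add: mat_inner_sum[where n = n and m = m] sum_distrib_left ac_simps)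

lemma mat_trace_mult_commute:
  fixes A B :: "complex mat"
  assumes "A \<in> carrier_mat n m" "B \<in> carrier_mat m n"
  shows "mat_trace (A * B) = mat_trace (B * A)"
proof -
  have "mat_trace (A * B) = (\<Sum>i<n. \<Sum>j<m. A $$ (i, j) * B $$ (j, i))"
    using assms by (auto simp: mat_trace_def scalar_prod_def lessThan_atLeast0)
  also have "\<dots> = (\<Sum>j<m. \<Sum>i<n. A $$ (i, j) * B $$ (j, i))"
    by (rule sum.swap)
  also have "\<dots> = mat_trace (B * A)"
    using assms by (auto simp: mat_trace_def scalar_prod_def lessThan_atLeast0 mult.commute)
  finally show ?thesis .
qed

lemma mat_inner_mult_right:
  assumes "X \<in> carrier_mat m m" "Y \<in> carrier_mat m m" "N \<in> carrier_mat m m"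
  shows "mat_inner (Y * X) N = mat_inner Y (N * mat_adjoint X)"
  using assms
  by (simp add: mat_inner_def mat_adjoint_mult[where n = m and k = m and m = m]
      assoc_mult_mat[where n\<^sub>1 = m and n\<^sub>2 = m and n\<^sub>3 = m and n\<^sub>4 = m])

lemma mat_inner_mult_left:
  assumes "X \<in> carrier_mat m m" "Y \<in> carrier_mat m m" "N \<in> carrier_mat m m"
  shows "mat_inner (X * Y) N = mat_inner Y (mat_adjoint X * N)"
  using assms mat_trace_mult_commute[of X m m "Y * mat_adjoint N"]
  by (simp add: mat_inner_def mat_adjoint_mult[where n = m and k = m and m = m]
      assoc_mult_mat[where n\<^sub>1 = m and n\<^sub>2 = m and n\<^sub>3 = m and n\<^sub>4 = m])

section \<open>Bounding the commutator by products with hermitian parts\<close>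

text \<open>The cross terms of \<open>|XY - YX|^2\<close> and \<open>|X*Y + YX*|^2\<close> are
  opposite, so the two squares add up to the four products; dropping the second square leaves the
  bound.\<close>

lemma frob_norm_commutator_le:
  fixes X Y :: "complex mat"
  assumes X: "X \<in> carrier_mat m m" and Y: "Y \<in> carrier_mat m m"
  shows "(frob_norm (commutator X Y))\<^sup>2 \<le> (frob_norm (X * Y))\<^sup>2 + (frob_norm (Y * X))\<^sup>2
    + (frob_norm (mat_adjoint X * Y))\<^sup>2 + (frob_norm (Y * mat_adjoint X))\<^sup>2"
proof -
  let ?X = "mat_adjoint X"
  note a = assoc_mult_mat[where n\<^sub>1 = m and n\<^sub>2 = m and n\<^sub>3 = m and n\<^sub>4 = m]
  have c: "X * Y \<in> carrier_mat m m" "Y * X \<in> carrier_mat m m"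
    "?X * Y \<in> carrier_mat m m" "Y * ?X \<in> carrier_mat m m" "?X \<in> carrier_mat m m"
    using X Y by auto
  \<comment> \<open>Both inner products equal \<open><Y, X* Y X>\<close>: the factor X moves across
    the first from the left, the factor X* across the second from the right.\<close>
  have "mat_inner (X * Y) (Y * X) = mat_inner Y (?X * (Y * X))"
    using X Y by (simp add: mat_inner_mult_left)
  also have "\<dots> = mat_inner Y ((?X * Y) * mat_adjoint ?X)"
    using X Y c by (simp add: a)
  also have "\<dots> = mat_inner (Y * ?X) (?X * Y)"
    using X Y c by (subst mat_inner_mult_right[where m = m]) auto
  finally have eq: "mat_inner (X * Y) (Y * X) = mat_inner (Y * ?X) (?X * Y)" .
  have "(frob_norm (commutator X Y))\<^sup>2 = (frob_norm (X * Y))\<^sup>2 + (frob_norm (Y * X))\<^sup>2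
      - 2 * Re (mat_inner (X * Y) (Y * X))"
    using c mat_inner_commute[of "X * Y" m m "Y * X"]
    by (simp add: commutator_def frob_norm_inner[where n = m and m = m] mat_inner_minus_left[where n = m and m = m]
       mat_inner_minus_right[where n = m and m = m] minus_carrier_mat)
  moreover have "(frob_norm (?X * Y + Y * ?X))\<^sup>2 = (frob_norm (?X * Y))\<^sup>2 + (frob_norm (Y * ?X))\<^sup>2
      + 2 * Re (mat_inner (Y * ?X) (?X * Y))"
    using c mat_inner_commute[of "?X * Y" m m "Y * ?X"]
    by (simp add: frob_norm_inner[where n = m and m = m] mat_inner_add_left[where n = m and m = m]
       mat_inner_add_right[where n = m and m = m])
  ultimately show ?thesis
    using eq zero_le_power2[of "frob_norm (?X * Y + Y * ?X)"] by simp
qed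

lemma frob_norm_parallelogram:
  assumes "A \<in> carrier_mat m m" "B \<in> carrier_mat m m"
  shows "(frob_norm (A + \<i> \<cdot>\<^sub>m B))\<^sup>2 + (frob_norm (A - \<i> \<cdot>\<^sub>m B))\<^sup>2 = 2 * ((frob_norm A)\<^sup>2 + (frob_norm B)\<^sup>2)"
proof -
  have "\<i> \<cdot>\<^sub>m B \<in> carrier_mat m m"
    using assms by simp
  then show ?thesis
    using assms
    by (simp add: frob_norm_inner[where n = m and m = m] mat_inner_add_left[where n = m and m = m]
       mat_inner_add_right[where n = m and m = m] mat_inner_minus_left[where n = m and m = m]
       mat_inner_minus_right[where n = m and m = m] minus_carrier_mat mat_inner_smult_left[where n = m and m = m]
       mat_inner_smult_right[where n = m and m = m])
qed

text \<open>For hermitian A and B the adjoint of \<open>A + iB\<close> is \<open>A - iB\<close>, so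
  the four products pair off into two parallelogram identities, one for left and one for right
  multiplication.\<close>

lemma frob_norm_commutator_hermitian_le:
  fixes A B Y :: "complex mat"
  assumes A: "A \<in> carrier_mat m m" "mat_adjoint A = A"
    and B: "B \<in> carrier_mat m m" "mat_adjoint B = B"
    and Y: "Y \<in> carrier_mat m m"
  shows "(frob_norm (commutator (A + \<i> \<cdot>\<^sub>m B) Y))\<^sup>2 \<le>
    2 * ((frob_norm (A * Y))\<^sup>2 + (frob_norm (Y * A))\<^sup>2)
    + 2 * ((frob_norm (B * Y))\<^sup>2 + (frob_norm (Y * B))\<^sup>2)"
proof -
  have adj: "mat_adjoint (A + \<i> \<cdot>\<^sub>m B) = A - \<i> \<cdot>\<^sub>m B"
    using A B by (subst mat_adjoint_add[where n = m and m = m]) (auto simp: mat_adjoint_smult)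
  have iB: "\<i> \<cdot>\<^sub>m B \<in> carrier_mat m m" "A + \<i> \<cdot>\<^sub>m B \<in> carrier_mat m m"
    using A B by auto
  have "(A + \<i> \<cdot>\<^sub>m B) * Y = A * Y + \<i> \<cdot>\<^sub>m (B * Y)" "(A - \<i> \<cdot>\<^sub>m B) * Y = A * Y - \<i> \<cdot>\<^sub>m (B * Y)"
    "Y * (A + \<i> \<cdot>\<^sub>m B) = Y * A + \<i> \<cdot>\<^sub>m (Y * B)" "Y * (A - \<i> \<cdot>\<^sub>m B) = Y * A - \<i> \<cdot>\<^sub>m (Y * B)"
    using A B Y iB
    by (simp_all add: add_mult_distrib_mat[where nr = m and n = m and nc = m] minus_mult_distrib_mat[where nr = m and n = m and nc = m]
        mult_add_distrib_mat[where nr = m and n = m and nc = m] mult_minus_distrib_mat[where nr = m and n = m and nc = m]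
        mult_smult_assoc_mat[where nr = m and n = m and nc = m] mult_smult_distrib[where nr = m and n = m and nc = m])
  then show ?thesis
    using frob_norm_commutator_le[OF iB(2) Y]
      frob_norm_parallelogram[of "A * Y" m "B * Y"] frob_norm_parallelogram[of "Y * A" m "Y * B"] A B Y
    by (simp add: adj)
qed

section \<open>Unitary diagonalization of hermitian matrices\<close>

lemma unitary_matI:
  assumes "U \<in> carrier_mat m m" "U * mat_adjoint U = 1\<^sub>m m"
  shows "unitary_mat m U"
  using assms mat_mult_left_right_inverse[of U m "mat_adjoint U"] by (auto simp: unitary_mat_def)

lemma unitary_matD:
  assumes "unitary_mat m U"
  shows "U \<in> carrier_mat m m" "mat_adjoint U \<in> carrier_mat m m"
    "mat_adjoint U * U = 1\<^sub>m m" "U * mat_adjoint U = 1\<^sub>m m"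
  using assms by (auto simp: unitary_mat_def)

lemma unitary_mat_adjoint: "unitary_mat m U \<Longrightarrow> unitary_mat m (mat_adjoint U)"
  by (auto simp: unitary_mat_def)

lemma unitary_mat_cancel:
  assumes "unitary_mat m U" "M \<in> carrier_mat m m"
  shows "mat_adjoint U * (U * M) = M" "U * (mat_adjoint U * M) = M"
  using unitary_matD[OF assms(1)] assms(2)
  by (simp_all flip: assoc_mult_mat[where n\<^sub>1 = m and n\<^sub>2 = m and n\<^sub>3 = m and n\<^sub>4 = m])

lemma unitary_mat_mult:
  assumes U: "unitary_mat m U" and V: "unitary_mat m V"
  shows "unitary_mat m (U * V)"
proof (rule unitary_matI)
  note u = unitary_matD[OF U] note v = unitary_matD[OF V]
  show "U * V \<in> carrier_mat m m"
    using u v by auto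
  show "U * V * mat_adjoint (U * V) = 1\<^sub>m m"
    using u v unitary_mat_cancel(2)[OF V, of "mat_adjoint U"]
    by (simp add: mat_adjoint_mult[where n = m and k = m and m = m]
       assoc_mult_mat[where n\<^sub>1 = m and n\<^sub>2 = m and n\<^sub>3 = m and n\<^sub>4 = m])
qed

text \<open>Complete v to a basis, orthogonalize with v kept in first place, and normalize the
  columns.\<close>

lemma unitary_mat_first_col:
  fixes v :: "complex vec"
  assumes v: "v \<in> carrier_vec m" and v0: "v \<noteq> 0\<^sub>v m"
  obtains W c where "unitary_mat m W" "col W 0 = c \<cdot>\<^sub>v v"
proof -
  interpret cof_vec_space m "TYPE(complex)" .
  define b where "b = basis_completion v"
  define ws where "ws = gram_schmidt m b"
  note bc = basis_completion[OF v v0, folded b_def]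
  have m: "0 < m"
    using v v0 by (cases m) auto
  obtain vs where bv: "b = v # vs"
    using bc(6,7) m by (cases b) auto
  have ws: "set ws \<subseteq> carrier_vec m" "corthogonal ws" "length ws = m"
    using gram_schmidt_result[OF bc(2,4,5) refl, folded ws_def] bc(6) by auto
  have hd: "ws ! 0 = v"
    using gram_schmidt_hd[OF v, of vs, folded bv] ws(3) m by (cases ws) (auto simp: ws_def)
  \<comment> \<open>The inverse length of the i-th vector; its product with itself is a complex
    number that is real and positive, hence the \<open>Re\<close>.\<close>
  define r where "r i = complex_of_real (1 / sqrt (Re (ws ! i \<bullet>c ws ! i)))" for i
  define W where "W = mat m m (\<lambda>(i, j). r j * (ws ! j $ i))"
  have W: "W \<in> carrier_mat m m"
    by (simp add: W_def)
  have wsc: "ws ! i \<in> carrier_vec m" if "i < m" for i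
    using ws that by auto
  have "mat_adjoint W * W = 1\<^sub>m m"
  proof (rule eq_matI)
    fix i j assume ij: "i < dim_row (1\<^sub>m m :: complex mat)" "j < dim_col (1\<^sub>m m :: complex mat)"
    then have ij: "i < m" "j < m" by auto
    have "(mat_adjoint W * W) $$ (i, j) = (\<Sum>l<m. cnj (r i * (ws ! i $ l)) * (r j * (ws ! j $ l)))"
      using ij W by (subst mat_mult_index[where n = m and k = m and m = m]) (auto simp: W_def)
    also have "\<dots> = r i * r j * (\<Sum>l<m. ws ! j $ l * cnj (ws ! i $ l))"
      by (simp add: sum_distrib_left r_def ac_simps flip: sum_divide_distrib)
    also have "(\<Sum>l<m. ws ! j $ l * cnj (ws ! i $ l)) = ws ! j \<bullet>c ws ! i"
      using wsc[OF ij(1)] wsc[OF ij(2)] by (simp add: scalar_prod_def lessThan_atLeast0)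
    also have "r i * r j * (ws ! j \<bullet>c ws ! i) = (1\<^sub>m m) $$ (i, j)"
    proof (cases "i = j")
      case True
      let ?s = "ws ! i \<bullet>c ws ! i"
      have ge: "?s \<ge> 0" by (rule conjugate_square_ge_0_vec)
      have "?s \<noteq> 0"
        using ws ij by (auto simp: corthogonalD)
      then have "?s = complex_of_real (Re ?s)" "Re ?s > 0"
        using ge by (auto simp: less_eq_complex_def complex_eq_iff)
      then have "r i * r i * ?s = complex_of_real ((1 / sqrt (Re ?s)) * (1 / sqrt (Re ?s)) * Re ?s)"
        unfolding r_def by (metis of_real_mult)
      also have "\<dots> = 1"
        using \<open>Re ?s > 0\<close> by simp
      finally show ?thesis
        using True ij by simp
    next
      case False
      then show ?thesis
        using ws ij corthogonalD[of ws j i] by auto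
    qed
    finally show "(mat_adjoint W * W) $$ (i, j) = (1\<^sub>m m) $$ (i, j)" .
  qed (use W in auto)
  then have "unitary_mat m (mat_adjoint W)"
    using W by (intro unitary_matI) auto
  then have "unitary_mat m W"
    using unitary_mat_adjoint by fastforce
  moreover have "col W 0 = r 0 \<cdot>\<^sub>v v"
    using hd v m by (intro eq_vecI) (auto simp: W_def)
  ultimately show ?thesis
    by (rule that)
qed

lemma hermitian_unitary_conj:
  fixes A Q :: "complex mat"
  assumes A: "A \<in> carrier_mat m m" "mat_adjoint A = A" and Q: "Q \<in> carrier_mat m m"
  shows "mat_adjoint (Q * A * mat_adjoint Q) = Q * A * mat_adjoint Q"
  using A Q
  by (simp add: mat_adjoint_mult[where n = m and k = m and m = m]
     assoc_mult_mat[where n\<^sub>1 = m and n\<^sub>2 = m and n\<^sub>3 = m and n\<^sub>4 = m])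

lemma mat_adjoint_four_block:
  fixes A :: "complex mat"
  assumes "A \<in> carrier_mat n1 m1" "B \<in> carrier_mat n1 m2" "C \<in> carrier_mat n2 m1" "D \<in> carrier_mat n2 m2"
  shows "mat_adjoint (four_block_mat A B C D) =
    four_block_mat (mat_adjoint A) (mat_adjoint C) (mat_adjoint B) (mat_adjoint D)"
  using assms by (intro eq_matI) auto

text \<open>Deflation: an eigenvector as first basis vector clears the rest of the first column,
  hermitian symmetry clears the rest of the first row, and the remaining block is hermitian of size
  one less.\<close>

lemma hermitian_diagonalization:
  fixes A :: "complex mat"
  assumes "A \<in> carrier_mat m m" "mat_adjoint A = A"
  shows "\<exists>Q. unitary_mat m Q \<and> diagonal_mat (Q * A * mat_adjoint Q)"
  using assms
proof (induction m arbitrary: A)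
  case 0
  then show ?case
    by (intro exI[of _ "1\<^sub>m 0"]) (auto simp: unitary_mat_def diagonal_mat_def)
next
  case (Suc k)
  let ?m = "Suc k"
  note assoc = assoc_mult_mat[where n\<^sub>1 = ?m and n\<^sub>2 = ?m and n\<^sub>3 = ?m and n\<^sub>4 = ?m]
  note A = Suc.prems
  obtain e v where "eigenvector A v e"
    using spectrum_non_empty[OF A(1)] by (auto simp: spectrum_def eigenvalue_def)
  then have v: "v \<in> carrier_vec ?m" "v \<noteq> 0\<^sub>v ?m" "A *\<^sub>v v = e \<cdot>\<^sub>v v"
    using A by (auto simp: eigenvector_def)
  from unitary_mat_first_col[OF v(1,2)] obtain W c
    where UW: "unitary_mat ?m W" and col: "col W 0 = c \<cdot>\<^sub>v v" .
  note W = unitary_matD[OF UW]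
  define A' where "A' = mat_adjoint W * A * W"
  have A': "A' \<in> carrier_mat ?m ?m" "mat_adjoint A' = A'"
    unfolding A'_def using hermitian_unitary_conj[OF A W(2), unfolded mat_adjoint_adjoint] A W
    by (blast intro: mult_square_carrier)+
  \<comment> \<open>The first column of W is still an eigenvector for e, so the first column of A'
    is e times the first column of \<open>W*W = 1\<close>.\<close>
  have col0: "A' $$ (i, 0) = (if i = 0 then e else 0)" if "i < ?m" for i
  proof -
    have "col (A * W) 0 = A *\<^sub>v col W 0"
      using A W by (intro col_mult2) auto
    also have "\<dots> = e \<cdot>\<^sub>v col W 0"
      using A v by (simp add: col mult_mat_vec smult_smult_assoc mult.commute)
    finally have c: "col (A * W) 0 = e \<cdot>\<^sub>v col W 0" .
    have "A' $$ (i, 0) = row (mat_adjoint W) i \<bullet> col (A * W) 0"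
      using A W that by (simp add: A'_def assoc)
    also have "\<dots> = e * (row (mat_adjoint W) i \<bullet> col W 0)"
      unfolding c using row_carrier[of "mat_adjoint W" i] col_dim[of W 0] W(1)
      by (intro scalar_prod_smult_distrib[of _ ?m]) (auto simp del: col_dim)
    also have "row (mat_adjoint W) i \<bullet> col W 0 = (mat_adjoint W * W) $$ (i, 0)"
      using W(1) that by auto
    finally show ?thesis
      using that by (simp add: W(3))
  qed
  have cnj: "A' $$ (i, j) = cnj (A' $$ (j, i))" if "i < ?m" "j < ?m" for i j
    using A'(1) that mat_adjoint_index[of i A' j] unfolding A'(2) by auto
  \<comment> \<open>At i = 0 the same symmetry shows that e is real.\<close>
  have row0: "A' $$ (0, i) = (if i = 0 then e else 0)" if "i < ?m" for i
    using cnj[of 0 i] cnj[of 0 0] col0[OF that] col0[of 0] that by (auto split: if_splits)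
  define A3 where "A3 = mat k k (\<lambda>(i, j). A' $$ (Suc i, Suc j))"
  have A3_carrier: "A3 \<in> carrier_mat k k"
    by (simp add: A3_def)
  have "mat_adjoint A3 = A3"
  proof (rule eq_matI)
    fix i j assume "i < dim_row A3" "j < dim_col A3"
    then show "mat_adjoint A3 $$ (i, j) = A3 $$ (i, j)"
      using cnj[of "Suc i" "Suc j"] by (simp add: A3_def)
  qed (simp_all add: A3_def)
  note A3 = A3_carrier this
  have A'b: "A' = four_block_mat (mat 1 1 (\<lambda>_. e)) (0\<^sub>m 1 k) (0\<^sub>m k 1) A3"
    using A' row0 col0 by (intro eq_matI) (auto simp: A3_def)
  obtain V where UV: "unitary_mat k V" and d: "diagonal_mat (V * A3 * mat_adjoint V)"
    using Suc.IH[OF A3] by blast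
  note V = unitary_matD[OF UV]
  \<comment> \<open>Bordering V by a 1 leaves the split-off eigenvalue alone and diagonalizes the
    lower block.\<close>
  define V1 where "V1 = four_block_mat (1\<^sub>m 1) (0\<^sub>m 1 k) (0\<^sub>m k 1) V"
  have V1: "V1 \<in> carrier_mat ?m ?m"
    using V by (auto simp: V1_def)
  have adj: "mat_adjoint V1 = four_block_mat (1\<^sub>m 1) (0\<^sub>m 1 k) (0\<^sub>m k 1) (mat_adjoint V)"
    unfolding V1_def using V by (subst mat_adjoint_four_block[of _ 1 1 _ k _ k]) auto
  have "V1 * mat_adjoint V1 = four_block_mat (1\<^sub>m 1) (0\<^sub>m 1 k) (0\<^sub>m k 1) (V * mat_adjoint V)"
    unfolding adj unfolding V1_def using V
    by (subst mult_four_block_mat[of _ 1 1 _ k _ k _ _ 1 _ k]) auto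
  also have "\<dots> = 1\<^sub>m ?m"
    unfolding V(4) by (intro eq_matI) auto
  finally have UV1: "unitary_mat ?m V1"
    using V1 by (intro unitary_matI)
  have "V1 * A' = four_block_mat (mat 1 1 (\<lambda>_. e)) (0\<^sub>m 1 k) (0\<^sub>m k 1) (V * A3)"
    unfolding A'b V1_def using V A3
    by (subst mult_four_block_mat[of _ 1 1 _ k _ k _ _ 1 _ k]) auto
  then have "V1 * A' * mat_adjoint V1 =
      four_block_mat (mat 1 1 (\<lambda>_. e)) (0\<^sub>m 1 k) (0\<^sub>m k 1) (V * A3 * mat_adjoint V)"
    unfolding adj using V A3
    by (simp only:) (subst mult_four_block_mat[of _ 1 1 _ k _ k _ _ 1 _ k], auto)
  moreover have "diagonal_mat (four_block_mat (mat 1 1 (\<lambda>_. e)) (0\<^sub>m 1 k) (0\<^sub>m k 1) B)"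
    if "B \<in> carrier_mat k k" "diagonal_mat B" for B
    using that by (auto simp: diagonal_mat_def)
  ultimately have "diagonal_mat (V1 * A' * mat_adjoint V1)"
    using d V A3 by simp
  moreover have "V1 * mat_adjoint W * A * mat_adjoint (V1 * mat_adjoint W) = V1 * A' * mat_adjoint V1"
    using V1 W A by (simp add: A'_def mat_adjoint_mult[where n = ?m and k = ?m and m = ?m] assoc)
  moreover have "unitary_mat ?m (V1 * mat_adjoint W)"
    by (intro unitary_mat_mult UV1 unitary_mat_adjoint UW)
  ultimately show ?case
    by metis
qed

definition diag_of :: "nat \<Rightarrow> (nat \<Rightarrow> 'a::zero) \<Rightarrow> 'a mat" where
  "diag_of m d = mat m m (\<lambda>(i, j). if i = j then d i else 0)"

lemma diag_of_carrier [simp]: "diag_of m d \<in> carrier_mat m m"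
  by (simp add: diag_of_def)

lemma diag_of_dim [simp]: "dim_row (diag_of m d) = m" "dim_col (diag_of m d) = m"
  by (simp_all add: diag_of_def)

lemma diag_of_index:
  "i < m \<Longrightarrow> j < m \<Longrightarrow> diag_of m d $$ (i, j) = (if i = j then d i else 0)"
  by (simp add: diag_of_def)

lemma diag_of_mult_index:
  fixes M :: "'a::semiring_0 mat"
  assumes "M \<in> carrier_mat m m" "i < m" "j < m"
  shows "(diag_of m d * M) $$ (i, j) = d i * M $$ (i, j)"
    and "(M * diag_of m d) $$ (i, j) = M $$ (i, j) * d j"
proof -
  show "(diag_of m d * M) $$ (i, j) = d i * M $$ (i, j)"
    using assms unfolding mat_mult_index[OF diag_of_carrier assms]
    by (simp add: diag_of_index if_distrib[where f = "\<lambda>x. x * _"] cong: if_cong)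
  show "(M * diag_of m d) $$ (i, j) = M $$ (i, j) * d j"
    using assms unfolding mat_mult_index[OF assms(1) diag_of_carrier assms(2,3)]
    by (simp add: diag_of_index if_distrib[where f = "\<lambda>x. _ * x"] cong: if_cong)
qed

text \<open>Ordering the eigenvalues by decreasing absolute value puts the two that survive in the
  equality case at positions 0 and 1, where the upper-left block of \<open>diag_zero\<close>
  sits.\<close>

lemma hermitian_diagonalization_sorted:
  fixes A :: "complex mat"
  assumes A: "A \<in> carrier_mat m m" "mat_adjoint A = A"
  obtains Q and a :: "nat \<Rightarrow> real" where "unitary_mat m Q"
    "Q * A * mat_adjoint Q = diag_of m (\<lambda>i. complex_of_real (a i))"
    "\<And>i j. i \<le> j \<Longrightarrow> j < m \<Longrightarrow> \<bar>a j\<bar> \<le> \<bar>a i\<bar>"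
proof -
  note assoc = assoc_mult_mat[where n\<^sub>1 = m and n\<^sub>2 = m and n\<^sub>3 = m and n\<^sub>4 = m]
  obtain Q where UQ: "unitary_mat m Q" and d: "diagonal_mat (Q * A * mat_adjoint Q)"
    using hermitian_diagonalization[OF A] by blast
  note Q = unitary_matD[OF UQ]
  define D where "D = Q * A * mat_adjoint Q"
  define d where "d i = Re (D $$ (i, i))" for i
  have D: "D \<in> carrier_mat m m" "mat_adjoint D = D"
    unfolding D_def using hermitian_unitary_conj[OF A Q(1)] A Q
    by (blast intro: mult_square_carrier)+
  have D_index: "D $$ (i, j) = (if i = j then complex_of_real (d i) else 0)" if "i < m" "j < m" for i j
  proof (cases "i = j")
    case True
    have "D $$ (i, i) = cnj (D $$ (i, i))"
      using D that mat_adjoint_index[of i D i] by auto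
    then show ?thesis
      using True by (simp add: d_def complex_eq_iff)
  next
    case False
    then show ?thesis
      using d that D by (auto simp: D_def diagonal_mat_def)
  qed
  define xs where "xs = sort_key (\<lambda>i. - \<bar>d i\<bar>) [0..<m]"
  have xs: "length xs = m" "distinct xs" "set xs = {..<m}" "sorted (map (\<lambda>i. - \<bar>d i\<bar>) xs)"
    by (auto simp: xs_def)
  have xs_less: "xs ! i < m" if "i < m" for i
    using xs that nth_mem[of i xs] by auto
  \<comment> \<open>The permutation matrix of the sorting: conjugation by P re-indexes rows and
    columns along \<open>xs\<close>. Applied to the identity, this also shows that P is
    unitary.\<close>
  define P where "P = mat m m (\<lambda>(i, j). if j = xs ! i then 1 else 0 :: complex)"
  have P: "P \<in> carrier_mat m m"
    by (simp add: P_def)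
  have conj: "(P * M * mat_adjoint P) $$ (i, j) = M $$ (xs ! i, xs ! j)"
    if "M \<in> carrier_mat m m" "i < m" "j < m" for M i j
  proof -
    have PM: "(P * M) $$ (i, l) = M $$ (xs ! i, l)" if "l < m" for l
    proof -
      have "(P * M) $$ (i, l) = (\<Sum>h<m. P $$ (i, h) * M $$ (h, l))"
        using mat_mult_index[OF P _ \<open>i < m\<close> that] \<open>M \<in> _\<close> by blast
      then show ?thesis
        using xs_less[OF \<open>i < m\<close>] \<open>i < m\<close> by (simp add: P_def if_distrib[where f = "\<lambda>x. x * _"] cong: if_cong)
    qed
    have Pj: "mat_adjoint P $$ (l, j) = (if l = xs ! j then 1 else 0)" if "l < m" for l
      using that \<open>j < m\<close> by (simp add: P_def)
    have "(P * M * mat_adjoint P) $$ (i, j) = (\<Sum>l<m. (P * M) $$ (i, l) * mat_adjoint P $$ (l, j))"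
      using mat_mult_index[of "P * M" m m "mat_adjoint P" m i j] that P by simp
    also have "\<dots> = (\<Sum>l<m. M $$ (xs ! i, l) * (if l = xs ! j then 1 else 0))"
      by (intro sum.cong) (simp_all only: PM Pj lessThan_iff)
    also have "\<dots> = M $$ (xs ! i, xs ! j)"
      using xs_less[OF \<open>j < m\<close>] by (simp add: if_distrib[where f = "\<lambda>x. _ * x"] cong: if_cong)
    finally show ?thesis .
  qed
  have "P * mat_adjoint P = P * 1\<^sub>m m * mat_adjoint P"
    using P by simp
  also have "\<dots> = mat m m (\<lambda>(i, j). 1\<^sub>m m $$ (xs ! i, xs ! j))"
    using P conj[OF one_carrier_mat] by (intro eq_matI) (simp_all del: index_mult_mat(1) right_mult_one_mat)
  also have "\<dots> = 1\<^sub>m m"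
    using xs xs_less by (intro eq_matI) (auto simp: nth_eq_iff_index_eq)
  finally have UP: "unitary_mat m P"
    using P by (intro unitary_matI)
  have "P * Q * A * mat_adjoint (P * Q) = P * D * mat_adjoint P"
    using P Q A by (simp add: D_def mat_adjoint_mult[where n = m and k = m and m = m] assoc)
  also have "\<dots> = diag_of m (\<lambda>i. complex_of_real (d (xs ! i)))"
    unfolding diag_of_def using P D xs xs_less by (intro eq_matI) (auto simp: conj D_index nth_eq_iff_index_eq simp del: index_mult_mat(1))
  finally show ?thesis
  proof (rule that[OF unitary_mat_mult[OF UP UQ], of "\<lambda>i. d (xs ! i)"])
    fix i j assume "i \<le> j" "j < m"
    then show "\<bar>d (xs ! j)\<bar> \<le> \<bar>d (xs ! i)\<bar>"
      using sorted_nth_mono[OF xs(4), of i j] xs(1) by auto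
  qed
qed

section \<open>A variance bound\<close>

text \<open>c is the mean of a under weights p of total mass 2s. The identity writes the gap in the
  variance bound as sums that are visibly nonnegative for nonnegative weights; both sides reduce to
  the moments \<open>S1\<close>, \<open>S2\<close>, \<open>A2\<close> and \<open>T\<close>.\<close>

lemma variance_defect:
  fixes p a :: "nat \<Rightarrow> real"
  assumes sum_p: "(\<Sum>i<m. p i) = 2 * s" and s: "s \<noteq> 0"
  defines "c \<equiv> (\<Sum>i<m. p i * a i) / (2 * s)"
  shows "2 * s\<^sup>2 * (\<Sum>i<m. (a i)\<^sup>2) - 2 * s * (\<Sum>i<m. p i * (a i - c)\<^sup>2) =
    2 * (\<Sum>i<m. (a i)\<^sup>2 * (s - p i)\<^sup>2)
    + (\<Sum>i<m. \<Sum>j<m. if i = j then 0 else p i * p j * (a i + a j)\<^sup>2) / 2"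
proof -
  define S1 where "S1 = (\<Sum>i<m. p i * a i)"
  define S2 where "S2 = (\<Sum>i<m. p i * (a i)\<^sup>2)"
  define A2 where "A2 = (\<Sum>i<m. (a i)\<^sup>2)"
  define T where "T = (\<Sum>i<m. (p i)\<^sup>2 * (a i)\<^sup>2)"
  have "(\<Sum>i<m. p i * (a i - c)\<^sup>2) = S2 - 2 * c * S1 + c\<^sup>2 * (\<Sum>i<m. p i)"
    by (simp add: S2_def S1_def power2_eq_square algebra_simps sum.distrib sum_subtractf
        sum_distrib_left)
  then have l: "2 * s * (\<Sum>i<m. p i * (a i - c)\<^sup>2) = 2 * s * S2 - S1\<^sup>2"
    using s by (simp add: c_def sum_p flip: S1_def) (simp add: field_simps power2_eq_square)
  have r1: "(\<Sum>i<m. (a i)\<^sup>2 * (s - p i)\<^sup>2) = s\<^sup>2 * A2 - 2 * s * S2 + T"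
    by (simp add: S2_def A2_def T_def power2_eq_square algebra_simps sum.distrib sum_subtractf
        sum_distrib_left)
  \<comment> \<open>The missing diagonal terms are \<open>4 p_i^2 a_i^2\<close>; adding and
    subtracting them gives a full double sum, which factors into moments.\<close>
  have "(\<Sum>i<m. \<Sum>j<m. if i = j then 0 else p i * p j * (a i + a j)\<^sup>2) =
      (\<Sum>i<m. \<Sum>j<m. p i * p j * (a i + a j)\<^sup>2 - (if i = j then 4 * (p i)\<^sup>2 * (a i)\<^sup>2 else 0))"
    by (intro sum.cong refl) (auto simp: power2_eq_square algebra_simps)
  also have "\<dots> = (\<Sum>i<m. \<Sum>j<m. p i * p j * (a i + a j)\<^sup>2) - 4 * T"
    by (simp add: sum_subtractf T_def sum_distrib_left mult.assoc)
  also have "(\<Sum>i<m. \<Sum>j<m. p i * p j * (a i + a j)\<^sup>2) =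
      (\<Sum>i<m. \<Sum>j<m. (p i * (a i)\<^sup>2) * p j + 2 * ((p i * a i) * (p j * a j)) + p i * (p j * (a j)\<^sup>2))"
    by (intro sum.cong refl) (simp add: power2_eq_square algebra_simps)
  also have "\<dots> = S2 * (2 * s) + 2 * (S1 * S1) + (2 * s) * S2"
    unfolding S1_def S2_def sum_p[symmetric] sum_product sum.distrib by (simp add: sum_distrib_left)
  finally show ?thesis
    unfolding l r1 A2_def[symmetric] by (simp add: power2_eq_square algebra_simps)
qed

text \<open>Equality kills every term of the defect: a nonzero \<open>a i\<close> carries weight
  exactly s, and two distinct indices of positive weight have opposite values. Since the total
  weight is 2s, exactly two indices carry weight.\<close>

lemma variance_bound:
  fixes p a :: "nat \<Rightarrow> real"
  assumes sum_p: "(\<Sum>i<m. p i) = 2 * s" and s: "s > 0" and p: "\<And>i. i < m \<Longrightarrow> 0 \<le> p i"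
  defines "c \<equiv> (\<Sum>i<m. p i * a i) / (2 * s)"
  shows "(\<Sum>i<m. p i * (a i - c)\<^sup>2) \<le> s * (\<Sum>i<m. (a i)\<^sup>2)"
    and "(\<Sum>i<m. p i * (a i - c)\<^sup>2) = s * (\<Sum>i<m. (a i)\<^sup>2) \<Longrightarrow>
      (\<And>i j. i \<le> j \<Longrightarrow> j < m \<Longrightarrow> \<bar>a j\<bar> \<le> \<bar>a i\<bar>) \<Longrightarrow> \<exists>i<m. a i \<noteq> 0 \<Longrightarrow>
      2 \<le> m \<and> a 0 \<noteq> 0 \<and> a 1 = - a 0 \<and> (\<forall>i<m. 2 \<le> i \<longrightarrow> a i = 0 \<and> p i = 0)"
proof -
  let ?L = "\<Sum>i<m. p i * (a i - c)\<^sup>2" and ?R = "\<Sum>i<m. (a i)\<^sup>2"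
  let ?E1 = "\<Sum>i<m. (a i)\<^sup>2 * (s - p i)\<^sup>2"
  let ?E2 = "\<Sum>i<m. \<Sum>j<m. if i = j then 0 else p i * p j * (a i + a j)\<^sup>2"
  have eq: "2 * s * (s * ?R - ?L) = 2 * ?E1 + ?E2 / 2"
    using variance_defect[OF sum_p, of a] s by (simp add: c_def power2_eq_square algebra_simps)
  have E1: "?E1 \<ge> 0"
    by (intro sum_nonneg) auto
  have E2: "?E2 \<ge> 0"
    using p by (intro sum_nonneg) auto
  have "0 \<le> 2 * s * (s * ?R - ?L)"
    unfolding eq using E1 E2 by simp
  then show "?L \<le> s * ?R"
    using s by (simp add: zero_le_mult_iff)
  assume "?L = s * ?R" and sorted: "\<And>i j. i \<le> j \<Longrightarrow> j < m \<Longrightarrow> \<bar>a j\<bar> \<le> \<bar>a i\<bar>"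
    and ne: "\<exists>i<m. a i \<noteq> 0"
  then have "?E1 = 0" "?E2 = 0"
    using eq E1 E2 by auto
  then have E1': "a i = 0 \<or> p i = s" if "i < m" for i
    using that by (auto simp: sum_nonneg_eq_0_iff)
  have E2': "p i = 0 \<or> p j = 0 \<or> a i + a j = 0" if "i < m" "j < m" "i \<noteq> j" for i j
  proof -
    have "\<forall>i<m. (\<Sum>j<m. if i = j then 0 else p i * p j * (a i + a j)\<^sup>2) = 0"
      using \<open>?E2 = 0\<close> p by (subst (asm) sum_nonneg_eq_0_iff) (auto intro!: sum_nonneg)
    then have "(\<Sum>j<m. if i = j then 0 else p i * p j * (a i + a j)\<^sup>2) = 0"
      using that by blast
    then have "\<forall>j<m. (if i = j then 0 else p i * p j * (a i + a j)\<^sup>2) = 0"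
      using p that by (subst (asm) sum_nonneg_eq_0_iff) auto
    then show ?thesis
      using that by auto
  qed
  \<comment> \<open>Index 0 has the largest absolute value, so some nonzero value makes this one
    nonzero.\<close>
  have m: "0 < m" and a0: "a 0 \<noteq> 0"
    using ne sorted by fastforce+
  then have p0: "p 0 = s"
    using E1' by blast
  have split0: "(\<Sum>i<m. p i) = s + (\<Sum>i\<in>{..<m} - {0}. p i)"
    using m by (subst sum.remove[of _ 0]) (auto simp: p0)
  \<comment> \<open>Index 0 holds only half of the mass 2s, so a second index j shares it; together
    they exhaust it and every other weight is 0.\<close>
  have "\<exists>j\<in>{..<m} - {0}. p j \<noteq> 0"
  proof (rule ccontr)
    assume "\<not> ?thesis"
    then have "(\<Sum>i\<in>{..<m} - {0}. p i) = 0"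
      by (intro sum.neutral) auto
    then show False
      using split0 sum_p s by simp
  qed
  then obtain j where j: "j < m" "j \<noteq> 0" "p j \<noteq> 0"
    by auto
  then have aj: "a j = - a 0"
    using E2'[of 0 j] m p0 s by auto
  have pj: "p j = s"
    using E1'[OF j(1)] aj a0 by auto
  have "(\<Sum>i<m. p i) = s + (s + (\<Sum>i\<in>{..<m} - {0} - {j}. p i))"
    unfolding split0 using j by (subst sum.remove[of "{..<m} - {0}" j]) (auto simp: pj)
  then have "(\<Sum>i\<in>{..<m} - {0} - {j}. p i) = 0"
    using sum_p by simp
  then have p_rest: "p i = 0" if "i < m" "i \<noteq> 0" "i \<noteq> j" for i
    using p that by (subst (asm) sum_nonneg_eq_0_iff) auto
  then have a_rest: "a i = 0" if "i < m" "i \<noteq> 0" "i \<noteq> j" for i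
    using E1'[OF that(1)] s that by auto
  \<comment> \<open>By the ordering \<open>a 1\<close> is at least as large in absolute value as the
    nonzero \<open>a j\<close>, but values away from 0 and j vanish.\<close>
  have "j = 1"
    using a_rest[of 1] sorted[of 1 j] j aj a0 by force
  then show "2 \<le> m \<and> a 0 \<noteq> 0 \<and> a 1 = - a 0 \<and> (\<forall>i<m. 2 \<le> i \<longrightarrow> a i = 0 \<and> p i = 0)"
    using j aj a0 a_rest p_rest by auto
qed

section \<open>Invariance under unitary conjugation\<close>

lemma frob_norm_unitary_conj:
  assumes U: "unitary_mat m U" and M: "M \<in> carrier_mat m m"
  shows "frob_norm (U * M * mat_adjoint U) = frob_norm M"
proof -
  note u = unitary_matD[OF U]
  have "mat_inner (U * M * mat_adjoint U) (U * M * mat_adjoint U) =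
      mat_inner M (mat_adjoint U * (U * M * mat_adjoint U * mat_adjoint (mat_adjoint U)))"
    using u M
    by (simp only: mat_inner_mult_right[of "mat_adjoint U" m "U * M"] mat_inner_mult_left[of U m M]
        mult_square_carrier mat_adjoint_carrier)
  also have "mat_adjoint U * (U * M * mat_adjoint U * mat_adjoint (mat_adjoint U)) = M"
    using u M unitary_mat_cancel[OF U, of M]
    by (simp add: assoc_mult_mat[where n\<^sub>1 = m and n\<^sub>2 = m and n\<^sub>3 = m and n\<^sub>4 = m])
  finally have "(frob_norm (U * M * mat_adjoint U))\<^sup>2 = (frob_norm M)\<^sup>2"
    using u M by (simp only: frob_norm_inner[where n = m and m = m] mult_square_carrier mat_adjoint_carrier)
  then show ?thesis
    by (simp add: frob_norm_nonneg)
qed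

lemma mat_trace_unitary_conj:
  assumes U: "unitary_mat m U" and M: "M \<in> carrier_mat m m"
  shows "mat_trace (U * M * mat_adjoint U) = mat_trace M"
proof -
  note u = unitary_matD[OF U]
  have "mat_trace (U * M * mat_adjoint U) = mat_trace (mat_adjoint U * (U * M))"
    using u M by (intro mat_trace_mult_commute) auto
  then show ?thesis
    using unitary_mat_cancel[OF U M] by simp
qed

lemma unitary_conj_mult:
  assumes U: "unitary_mat m U" and M: "M \<in> carrier_mat m m" "N \<in> carrier_mat m m"
  shows "U * (M * N) * mat_adjoint U = (U * M * mat_adjoint U) * (U * N * mat_adjoint U)"
  using unitary_matD[OF U] M unitary_mat_cancel(1)[OF U, of "N * mat_adjoint U"]
  by (simp add: assoc_mult_mat[where n\<^sub>1 = m and n\<^sub>2 = m and n\<^sub>3 = m and n\<^sub>4 = m])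

lemma unitary_conj_eq:
  assumes U: "unitary_mat m U" and M: "M \<in> carrier_mat m m"
  shows "mat_adjoint U * (U * M * mat_adjoint U) * U = M"
proof -
  note u = unitary_matD[OF U]
  have "mat_adjoint U * (U * M * mat_adjoint U) * U = mat_adjoint U * (U * (M * (mat_adjoint U * U)))"
    using u M by (simp add: assoc_mult_mat[where n\<^sub>1 = m and n\<^sub>2 = m and n\<^sub>3 = m and n\<^sub>4 = m] del: u)
  also have "\<dots> = M"
    using u M unitary_mat_cancel(1)[OF U M] by simp
  finally show ?thesis .
qed

lemma unitary_mult_eq_0:
  assumes U: "unitary_mat m U" and M: "M \<in> carrier_mat m m" and 0: "U * M = 0\<^sub>m m m"
  shows "M = 0\<^sub>m m m"
  using unitary_mat_cancel(1)[OF U M] unitary_matD[OF U] unfolding 0 by simp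

section \<open>The variance bound for products with a hermitian matrix\<close>

text \<open>In an eigenbasis of H the left-hand side is the variance of the spectrum for the best
  shift c. Inclusions of kernels are phrased through square matrices V with
  \<open>H * V = 0\<close>, whose columns lie in the kernel; the columns of
  \<open>mat_adjoint Q\<close> from index 2 on are such kernel vectors.\<close>

lemma hermitian_product_bound:
  fixes H Y :: "complex mat"
  assumes H: "H \<in> carrier_mat m m" "mat_adjoint H = H"
    and Y: "Y \<in> carrier_mat m m" "frob_norm Y \<noteq> 0"
  obtains c :: real
  where "(frob_norm ((H - complex_of_real c \<cdot>\<^sub>m 1\<^sub>m m) * Y))\<^sup>2 + (frob_norm (Y * (H - complex_of_real c \<cdot>\<^sub>m 1\<^sub>m m)))\<^sup>2
      \<le> (frob_norm H)\<^sup>2 * (frob_norm Y)\<^sup>2"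
    and "(frob_norm ((H - complex_of_real c \<cdot>\<^sub>m 1\<^sub>m m) * Y))\<^sup>2 + (frob_norm (Y * (H - complex_of_real c \<cdot>\<^sub>m 1\<^sub>m m)))\<^sup>2
      = (frob_norm H)\<^sup>2 * (frob_norm Y)\<^sup>2 \<longrightarrow>
      H \<noteq> 0\<^sub>m m m \<longrightarrow> 2 \<le> m \<and> mat_trace H = 0 \<and>
      (\<exists>Q. unitary_mat m Q \<and>
         H * (mat_adjoint Q * diag_of m (\<lambda>i. if i < 2 then 0 else 1)) = 0\<^sub>m m m \<and>
         (\<forall>V\<in>carrier_mat m m. H * V = 0\<^sub>m m m \<longrightarrow> Y * V = 0\<^sub>m m m \<and> mat_adjoint Y * V = 0\<^sub>m m m))"
proof -
  note assoc = assoc_mult_mat[where n\<^sub>1 = m and n\<^sub>2 = m and n\<^sub>3 = m and n\<^sub>4 = m]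
  obtain Q a where UQ: "unitary_mat m Q"
    and QHQ: "Q * H * mat_adjoint Q = diag_of m (\<lambda>i. complex_of_real (a i))"
    and sorted: "\<And>i j. i \<le> j \<Longrightarrow> j < m \<Longrightarrow> \<bar>a j\<bar> \<le> \<bar>a i\<bar>"
    using hermitian_diagonalization_sorted[OF H] by blast
  note Q = unitary_matD[OF UQ]
  define Z where "Z = Q * Y * mat_adjoint Q"
  have Z: "Z \<in> carrier_mat m m"
    using Q Y by (simp add: Z_def)
  define s where "s = (frob_norm Y)\<^sup>2"
  have s: "s > 0"
    using Y by (simp add: s_def)
  \<comment> \<open>Row mass plus column mass: a diagonal factor scales rows from the left and
    columns from the right. Every entry of Z is counted twice in total, whence the mass 2s.\<close>
  define p where "p i = (\<Sum>j<m. (cmod (Z $$ (i, j)))\<^sup>2) + (\<Sum>j<m. (cmod (Z $$ (j, i)))\<^sup>2)" for i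
  have p_nonneg: "0 \<le> p i" for i
    by (simp add: p_def sum_nonneg)
  have s_eq: "s = (\<Sum>i<m. \<Sum>j<m. (cmod (Z $$ (i, j)))\<^sup>2)"
    using frob_norm_unitary_conj[OF UQ Y(1)] frob_norm_sq[OF Z] by (simp add: s_def Z_def)
  have sum_p: "(\<Sum>i<m. p i) = 2 * s"
    using sum.swap[of "\<lambda>i j. (cmod (Z $$ (j, i)))\<^sup>2" "{..<m}" "{..<m}"]
    by (simp add: p_def sum.distrib s_eq)
  define c where "c = (\<Sum>i<m. p i * a i) / (2 * s)"
  define K where "K = H - complex_of_real c \<cdot>\<^sub>m 1\<^sub>m m"
  have K: "K \<in> carrier_mat m m"
    using H by (simp add: K_def)
  have "Q * K * mat_adjoint Q = Q * H * mat_adjoint Q - complex_of_real c \<cdot>\<^sub>m 1\<^sub>m m"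
    using Q H unfolding K_def
    by (simp add: mult_minus_distrib_mat[where nr = m and n = m and nc = m]
        minus_mult_distrib_mat[where nr = m and n = m and nc = m]
        mult_smult_distrib[where nr = m and n = m and nc = m] mult_smult_assoc_mat[where nr = m and n = m and nc = m])
  also have "\<dots> = diag_of m (\<lambda>i. complex_of_real (a i - c))"
    unfolding QHQ by (intro eq_matI) (auto simp: diag_of_def)
  finally have QKQ: "Q * K * mat_adjoint Q = diag_of m (\<lambda>i. complex_of_real (a i - c))" .
  have KY: "frob_norm (K * Y) = frob_norm (diag_of m (\<lambda>i. complex_of_real (a i - c)) * Z)"
    using frob_norm_unitary_conj[OF UQ, of "K * Y"] unitary_conj_mult[OF UQ K Y(1)] K Y
    by (simp add: QKQ Z_def)
  have YK: "frob_norm (Y * K) = frob_norm (Z * diag_of m (\<lambda>i. complex_of_real (a i - c)))"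
    using frob_norm_unitary_conj[OF UQ, of "Y * K"] unitary_conj_mult[OF UQ Y(1) K] K Y
    by (simp add: QKQ Z_def)
  have "(frob_norm (K * Y))\<^sup>2 = (\<Sum>i<m. \<Sum>j<m. (a i - c)\<^sup>2 * (cmod (Z $$ (i, j)))\<^sup>2)"
    unfolding KY frob_norm_sq[OF mult_square_carrier[OF diag_of_carrier Z]]
    using Z by (intro sum.cong refl)
      (simp add: diag_of_mult_index norm_mult power_mult_distrib del: index_mult_mat(1) of_real_diff)
  moreover have "(frob_norm (Y * K))\<^sup>2 = (\<Sum>i<m. \<Sum>j<m. (a j - c)\<^sup>2 * (cmod (Z $$ (i, j)))\<^sup>2)"
    unfolding YK frob_norm_sq[OF mult_square_carrier[OF Z diag_of_carrier]]
    using Z by (intro sum.cong refl)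
      (simp add: diag_of_mult_index norm_mult power_mult_distrib del: index_mult_mat(1) of_real_diff)
  moreover have "(\<Sum>i<m. \<Sum>j<m. (a j - c)\<^sup>2 * (cmod (Z $$ (i, j)))\<^sup>2) = (\<Sum>j<m. \<Sum>i<m. (a j - c)\<^sup>2 * (cmod (Z $$ (i, j)))\<^sup>2)"
    by (rule sum.swap)
  ultimately have L: "(frob_norm (K * Y))\<^sup>2 + (frob_norm (Y * K))\<^sup>2 = (\<Sum>i<m. p i * (a i - c)\<^sup>2)"
    by (simp add: p_def sum.distrib sum_distrib_left algebra_simps)
  have "(frob_norm H)\<^sup>2 = (\<Sum>i<m. \<Sum>j<m. (cmod (diag_of m (\<lambda>i. complex_of_real (a i)) $$ (i, j)))\<^sup>2)"
    using frob_norm_unitary_conj[OF UQ H(1)] frob_norm_sq[OF diag_of_carrier, of m "\<lambda>i. complex_of_real (a i)"]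
    by (simp add: QHQ)
  also have "\<dots> = (\<Sum>i<m. \<Sum>j<m. if i = j then (a i)\<^sup>2 else 0)"
    by (intro sum.cong refl) (auto simp: diag_of_index)
  also have "\<dots> = (\<Sum>i<m. (a i)\<^sup>2)"
    by simp
  finally have H_norm: "(frob_norm H)\<^sup>2 = (\<Sum>i<m. (a i)\<^sup>2)" .
  note bound = variance_bound[OF sum_p s p_nonneg, of a, folded c_def]
  show ?thesis
  proof (rule that[of c], unfold K_def[symmetric])
    show "(frob_norm (K * Y))\<^sup>2 + (frob_norm (Y * K))\<^sup>2 \<le> (frob_norm H)\<^sup>2 * (frob_norm Y)\<^sup>2"
      using bound(1) by (simp add: L H_norm s_def mult.commute)
  next
    \<comment> \<open>The projection onto the coordinates from index 2 on, where the spectrum of H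
      vanishes in the equality case.\<close>
    let ?E = "diag_of m (\<lambda>i. if i < 2 then 0 else 1) :: complex mat"
    show "(frob_norm (K * Y))\<^sup>2 + (frob_norm (Y * K))\<^sup>2 = (frob_norm H)\<^sup>2 * (frob_norm Y)\<^sup>2 \<longrightarrow>
      H \<noteq> 0\<^sub>m m m \<longrightarrow> 2 \<le> m \<and> mat_trace H = 0 \<and> (\<exists>Q. unitary_mat m Q \<and>
         H * (mat_adjoint Q * ?E) = 0\<^sub>m m m \<and>
         (\<forall>V\<in>carrier_mat m m. H * V = 0\<^sub>m m m \<longrightarrow> Y * V = 0\<^sub>m m m \<and> mat_adjoint Y * V = 0\<^sub>m m m))"
    proof (intro impI)
      assume eq: "(frob_norm (K * Y))\<^sup>2 + (frob_norm (Y * K))\<^sup>2 = (frob_norm H)\<^sup>2 * (frob_norm Y)\<^sup>2"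
        and "H \<noteq> 0\<^sub>m m m"
      then have "(\<Sum>i<m. (a i)\<^sup>2) \<noteq> 0"
        using frob_norm_eq_0[OF H(1)] by (simp flip: H_norm)
      then have ne: "\<exists>i<m. a i \<noteq> 0"
        by (auto intro: sum.neutral)
      have "(\<Sum>i<m. p i * (a i - c)\<^sup>2) = s * (\<Sum>i<m. (a i)\<^sup>2)"
        using eq by (simp add: L H_norm s_def mult.commute)
      note res = bound(2)[OF this sorted ne]
      have m: "2 \<le> m" and a0: "a 0 \<noteq> 0" and a1: "a 1 = - a 0"
        and rest: "\<And>i. i < m \<Longrightarrow> 2 \<le> i \<Longrightarrow> a i = 0 \<and> p i = 0"
        using res by blast+
      have "mat_trace H = (\<Sum>i<m. complex_of_real (a i))"
        using mat_trace_unitary_conj[OF UQ H(1)] by (simp add: QHQ mat_trace_def diag_of_def)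
      also have "\<dots> = (\<Sum>i<2. complex_of_real (a i))"
        using m rest by (intro sum.mono_neutral_right) auto
      also have "\<dots> = 0"
        by (simp add: numeral_2_eq_2 a1[simplified])
      finally have tr: "mat_trace H = 0" .
      let ?D = "diag_of m (\<lambda>i. complex_of_real (a i))"
      have DE: "?D * ?E = 0\<^sub>m m m"
        using rest by (intro eq_matI) (auto simp: diag_of_mult_index diag_of_index simp del: index_mult_mat(1))
      have HE: "H * (mat_adjoint Q * ?E) = 0\<^sub>m m m"
      proof (rule unitary_mult_eq_0[OF UQ])
        show "H * (mat_adjoint Q * ?E) \<in> carrier_mat m m"
          using Q(2) H(1) by (intro mult_square_carrier diag_of_carrier)
        show "Q * (H * (mat_adjoint Q * ?E)) = 0\<^sub>m m m"
          unfolding DE[symmetric] unfolding QHQ[symmetric] using Q(1) H(1) by (simp add: assoc)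
      qed
      \<comment> \<open>Weight 0 at index i means that row i and column i of Z vanish, so Z lives in
        its upper-left two-by-two corner.\<close>
      have Z0: "Z $$ (i, j) = 0 \<and> Z $$ (j, i) = 0" if "i < m" "j < m" "2 \<le> i" for i j
      proof -
        have "(\<Sum>j<m. (cmod (Z $$ (i, j)))\<^sup>2) = 0" "(\<Sum>j<m. (cmod (Z $$ (j, i)))\<^sup>2) = 0"
          using rest[OF that(1,3)] by (simp_all add: p_def add_nonneg_eq_0_iff sum_nonneg)
        then show ?thesis
          using that by (auto simp: sum_nonneg_eq_0_iff)
      qed
      have "Y * V = 0\<^sub>m m m \<and> mat_adjoint Y * V = 0\<^sub>m m m"
        if V: "V \<in> carrier_mat m m" and HV: "H * V = 0\<^sub>m m m" for V
      proof -
        define W where "W = Q * V"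
        have W: "W \<in> carrier_mat m m"
          using Q V by (simp add: W_def)
        have "?D * W = Q * (H * V)"
          unfolding QHQ[symmetric] W_def using Q H V unitary_mat_cancel(1)[OF UQ V] by (simp add: assoc)
        then have DW: "?D * W = 0\<^sub>m m m"
          using Q by (simp add: HV)
        \<comment> \<open>The first two eigenvalues are nonzero, so a matrix killed by H has, in the
          eigenbasis, zero rows 0 and 1. Z and its adjoint have support only in columns 0 and 1 and
          therefore kill it too.\<close>
        have W0: "W $$ (i, j) = 0" if "i < m" "j < m" "i < 2" for i j
        proof -
          have "a i \<noteq> 0"
            using a0 a1 \<open>i < 2\<close> by (auto simp: less_2_cases_iff)
          moreover have "complex_of_real (a i) * W $$ (i, j) = 0"
            using diag_of_mult_index(1)[OF W that(1,2), of "\<lambda>i. complex_of_real (a i)"] that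
            unfolding DW by simp
          ultimately show ?thesis by simp
        qed
        have kill: "N * W = 0\<^sub>m m m"
          if N: "N \<in> carrier_mat m m" and N0: "\<And>i j. i < m \<Longrightarrow> j < m \<Longrightarrow> 2 \<le> j \<Longrightarrow> N $$ (i, j) = 0" for N
        proof (rule eq_matI)
          fix i j assume "i < dim_row (0\<^sub>m m m :: complex mat)" "j < dim_col (0\<^sub>m m m :: complex mat)"
          then have ij: "i < m" "j < m" by auto
          have "(N * W) $$ (i, j) = (\<Sum>l<m. N $$ (i, l) * W $$ (l, j))"
            by (rule mat_mult_index[OF N W ij])
          also have "\<dots> = 0"
          proof (rule sum.neutral, rule ballI)
            fix l assume "l \<in> {..<m}"
            then show "N $$ (i, l) * W $$ (l, j) = 0"
              using N0[OF ij(1), of l] W0[of l j] ij by (cases "l < 2") auto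
          qed
          finally show "(N * W) $$ (i, j) = 0\<^sub>m m m $$ (i, j)"
            using ij by simp
        qed (use N W in auto)
        have "Q * (Y * V) = Z * W"
          using Q Y V unitary_mat_cancel(1)[OF UQ V] by (simp add: assoc W_def Z_def)
        moreover have "Q * (mat_adjoint Y * V) = mat_adjoint Z * W"
          using Q Y V unitary_mat_cancel(1)[OF UQ V]
          by (simp add: assoc W_def Z_def mat_adjoint_mult[where n = m and k = m and m = m])
        moreover have "Z * W = 0\<^sub>m m m" "mat_adjoint Z * W = 0\<^sub>m m m"
          using Z Z0 by (auto intro!: kill)
        ultimately show ?thesis
          using Q Y V by (auto intro!: unitary_mult_eq_0[OF UQ])
      qed
      then show "2 \<le> m \<and> mat_trace H = 0 \<and> (\<exists>Q. unitary_mat m Q \<and>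
           H * (mat_adjoint Q * ?E) = 0\<^sub>m m m \<and>
           (\<forall>V\<in>carrier_mat m m. H * V = 0\<^sub>m m m \<longrightarrow> Y * V = 0\<^sub>m m m \<and> mat_adjoint Y * V = 0\<^sub>m m m))"
        using m tr UQ HE by blast
    qed
  qed
qed

section \<open>The Boettcher-Wenzel inequality\<close>

text \<open>The norm splits by the parallelogram identity, since X and its adjoint have equal norm.
  The kernel statement holds because A and B are linear combinations of X and its adjoint.\<close>

lemma hermitian_parts:
  fixes X :: "complex mat"
  assumes X: "X \<in> carrier_mat m m"
  obtains A B where "A \<in> carrier_mat m m" "mat_adjoint A = A" "B \<in> carrier_mat m m" "mat_adjoint B = B"
    "X = A + \<i> \<cdot>\<^sub>m B" "(frob_norm X)\<^sup>2 = (frob_norm A)\<^sup>2 + (frob_norm B)\<^sup>2"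
    "\<And>V. V \<in> carrier_mat m m \<Longrightarrow> X * V = 0\<^sub>m m m \<Longrightarrow> mat_adjoint X * V = 0\<^sub>m m m \<Longrightarrow>
       A * V = 0\<^sub>m m m \<and> B * V = 0\<^sub>m m m"
proof -
  define A where "A = (1 / 2) \<cdot>\<^sub>m (X + mat_adjoint X)"
  define B where "B = (- \<i> / 2) \<cdot>\<^sub>m (X - mat_adjoint X)"
  have A: "A \<in> carrier_mat m m" "mat_adjoint A = A"
    using X by (auto simp: A_def intro!: eq_matI)
  have B: "B \<in> carrier_mat m m" "mat_adjoint B = B"
    using X by (auto simp: B_def algebra_simps intro!: eq_matI)
  have X_eq: "X = A + \<i> \<cdot>\<^sub>m B"
    using X by (auto simp: A_def B_def field_simps intro!: eq_matI)
  have adj: "mat_adjoint X = A - \<i> \<cdot>\<^sub>m B"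
    using X by (auto simp: A_def B_def field_simps intro!: eq_matI)
  have "(frob_norm (mat_adjoint X))\<^sup>2 = (frob_norm X)\<^sup>2"
    using X sum.swap[of "\<lambda>i j. (cmod (X $$ (j, i)))\<^sup>2" "{..<m}" "{..<m}"]
    by (simp add: frob_norm_sq[where n = m and m = m])
  then have "(frob_norm X)\<^sup>2 = (frob_norm A)\<^sup>2 + (frob_norm B)\<^sup>2"
    using frob_norm_parallelogram[OF A(1) B(1)] unfolding adj by (simp flip: X_eq)
  moreover have "A * V = 0\<^sub>m m m \<and> B * V = 0\<^sub>m m m"
    if "V \<in> carrier_mat m m" "X * V = 0\<^sub>m m m" "mat_adjoint X * V = 0\<^sub>m m m" for V
    using that X unfolding A_def B_def
    by (simp add: mult_smult_assoc_mat[where nr = m and n = m and nc = m]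
        add_mult_distrib_mat[where nr = m and n = m and nc = m]
        minus_mult_distrib_mat[where nr = m and n = m and nc = m]) auto
  ultimately show ?thesis
    using that A B X_eq by blast
qed

text \<open>Scalar matrices commute with everything; this allows each hermitian part to be centred
  at its own mean.\<close>

lemma commutator_shift:
  fixes X Y :: "complex mat"
  assumes "X \<in> carrier_mat m m" "Y \<in> carrier_mat m m"
  shows "commutator (X - z \<cdot>\<^sub>m 1\<^sub>m m) Y = commutator X Y"
proof -
  have z: "z \<cdot>\<^sub>m 1\<^sub>m m \<in> carrier_mat m m"
    by simp
  have "commutator (X - z \<cdot>\<^sub>m 1\<^sub>m m) Y = (X * Y - z \<cdot>\<^sub>m Y) - (Y * X - z \<cdot>\<^sub>m Y)"
    using assms z unfolding commutator_def
    by (simp add: minus_mult_distrib_mat[where nr = m and n = m and nc = m]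
        mult_minus_distrib_mat[where nr = m and n = m and nc = m]
        mult_smult_assoc_mat[where nr = m and n = m and nc = m] mult_smult_distrib[where nr = m and n = m and nc = m])
  also have "\<dots> = commutator X Y"
    using assms unfolding commutator_def by (intro eq_matI) auto
  finally show ?thesis .
qed

text \<open>In the equality statement H is a nonzero hermitian part of X. Its kernel lies between
  the common kernel of X and X* and that of Y and Y*, and it contains the last \<open>m - 2\<close>
  vectors of an orthonormal basis. The statement is asymmetric so that it can be used again with X
  and Y exchanged.\<close>

lemma boettcher_wenzel:
  fixes X Y :: "complex mat"
  assumes X: "X \<in> carrier_mat m m" and Y: "Y \<in> carrier_mat m m"
  shows "(frob_norm (commutator X Y))\<^sup>2 \<le> 2 * (frob_norm X)\<^sup>2 * (frob_norm Y)\<^sup>2"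
    and "(frob_norm (commutator X Y))\<^sup>2 = 2 * (frob_norm X)\<^sup>2 * (frob_norm Y)\<^sup>2 \<Longrightarrow>
      frob_norm X \<noteq> 0 \<Longrightarrow> frob_norm Y \<noteq> 0 \<Longrightarrow>
      2 \<le> m \<and> mat_trace X = 0 \<and> (\<exists>H Q. unitary_mat m Q \<and>
         H * (mat_adjoint Q * diag_of m (\<lambda>i. if i < 2 then 0 else 1)) = 0\<^sub>m m m \<and>
         (\<forall>V\<in>carrier_mat m m. X * V = 0\<^sub>m m m \<longrightarrow> mat_adjoint X * V = 0\<^sub>m m m \<longrightarrow> H * V = 0\<^sub>m m m) \<and>
         (\<forall>V\<in>carrier_mat m m. H * V = 0\<^sub>m m m \<longrightarrow> Y * V = 0\<^sub>m m m \<and> mat_adjoint Y * V = 0\<^sub>m m m))"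
proof -
  let ?r = "\<lambda>c. complex_of_real c \<cdot>\<^sub>m 1\<^sub>m m :: complex mat"
  let ?P = "\<lambda>H. H \<noteq> 0\<^sub>m m m \<longrightarrow> 2 \<le> m \<and> mat_trace H = 0 \<and>
    (\<exists>Q. unitary_mat m Q \<and>
       H * (mat_adjoint Q * diag_of m (\<lambda>i. if i < 2 then 0 else 1)) = 0\<^sub>m m m \<and>
       (\<forall>V\<in>carrier_mat m m. H * V = 0\<^sub>m m m \<longrightarrow> Y * V = 0\<^sub>m m m \<and> mat_adjoint Y * V = 0\<^sub>m m m))"
  obtain A B where A: "A \<in> carrier_mat m m" "mat_adjoint A = A"
    and B: "B \<in> carrier_mat m m" "mat_adjoint B = B"
    and X_eq: "X = A + \<i> \<cdot>\<^sub>m B" and norm_X: "(frob_norm X)\<^sup>2 = (frob_norm A)\<^sup>2 + (frob_norm B)\<^sup>2"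
    and ker: "\<And>V. V \<in> carrier_mat m m \<Longrightarrow> X * V = 0\<^sub>m m m \<Longrightarrow> mat_adjoint X * V = 0\<^sub>m m m \<Longrightarrow>
       A * V = 0\<^sub>m m m \<and> B * V = 0\<^sub>m m m"
    using hermitian_parts[OF X] by metis
  have main: "(frob_norm (commutator X Y))\<^sup>2 \<le> 2 * (frob_norm X)\<^sup>2 * (frob_norm Y)\<^sup>2 \<and>
    ((frob_norm (commutator X Y))\<^sup>2 = 2 * (frob_norm X)\<^sup>2 * (frob_norm Y)\<^sup>2 \<longrightarrow> ?P A \<and> ?P B)"
    if Y0: "frob_norm Y \<noteq> 0"
  proof -
    let ?f = "\<lambda>H c. (frob_norm ((H - ?r c) * Y))\<^sup>2 + (frob_norm (Y * (H - ?r c)))\<^sup>2"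
    obtain c where c: "?f A c \<le> (frob_norm A)\<^sup>2 * (frob_norm Y)\<^sup>2"
      "?f A c = (frob_norm A)\<^sup>2 * (frob_norm Y)\<^sup>2 \<longrightarrow> ?P A"
      by (rule hermitian_product_bound[OF A Y Y0])
    obtain d where d: "?f B d \<le> (frob_norm B)\<^sup>2 * (frob_norm Y)\<^sup>2"
      "?f B d = (frob_norm B)\<^sup>2 * (frob_norm Y)\<^sup>2 \<longrightarrow> ?P B"
      by (rule hermitian_product_bound[OF B Y Y0])
    have herm: "mat_adjoint (H - ?r t) = H - ?r t" if "H \<in> carrier_mat m m" "mat_adjoint H = H" for H t
      using that by (subst mat_adjoint_minus[where n = m and m = m]) (auto simp: mat_adjoint_smult)
    \<comment> \<open>Two independent real shifts of the hermitian parts amount to one complex shift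
      of X.\<close>
    have shift: "(A - ?r c) + \<i> \<cdot>\<^sub>m (B - ?r d) = X - (complex_of_real c + \<i> * complex_of_real d) \<cdot>\<^sub>m 1\<^sub>m m"
      unfolding X_eq using A B by (intro eq_matI) (auto simp: algebra_simps)
    have le: "(frob_norm (commutator X Y))\<^sup>2 \<le> 2 * ?f A c + 2 * ?f B d"
      using frob_norm_commutator_hermitian_le[OF _ herm[OF A] _ herm[OF B] Y, of c d] A B
      unfolding shift commutator_shift[OF X Y] by simp
    show ?thesis
    proof (intro conjI impI[of "_ = _ * _"])
      show "(frob_norm (commutator X Y))\<^sup>2 \<le> 2 * (frob_norm X)\<^sup>2 * (frob_norm Y)\<^sup>2"
        using le c(1) d(1) unfolding norm_X by (simp add: algebra_simps)
      assume "(frob_norm (commutator X Y))\<^sup>2 = 2 * (frob_norm X)\<^sup>2 * (frob_norm Y)\<^sup>2"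
      \<comment> \<open>Two upper bounds whose sum is attained are each attained.\<close>
      then have "?f A c = (frob_norm A)\<^sup>2 * (frob_norm Y)\<^sup>2" "?f B d = (frob_norm B)\<^sup>2 * (frob_norm Y)\<^sup>2"
        using le c(1) d(1) unfolding norm_X by (simp_all add: algebra_simps)
      then show "?P A" "?P B"
        using c(2) d(2) by simp_all
    qed
  qed
  show "(frob_norm (commutator X Y))\<^sup>2 \<le> 2 * (frob_norm X)\<^sup>2 * (frob_norm Y)\<^sup>2"
  proof (cases "frob_norm Y = 0")
    case True
    then have "commutator X Y = 0\<^sub>m m m"
      using X Y by (simp add: frob_norm_eq_0 commutator_def)
    then have "frob_norm (commutator X Y) = 0"
      using frob_norm_eq_0[of "0\<^sub>m m m" m m] by simp
    then show ?thesis by simp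
  qed (use main in blast)
  assume "(frob_norm (commutator X Y))\<^sup>2 = 2 * (frob_norm X)\<^sup>2 * (frob_norm Y)\<^sup>2"
    and X0: "frob_norm X \<noteq> 0" and Y0: "frob_norm Y \<noteq> 0"
  then have P: "?P A" "?P B"
    using main by blast+
  have tr: "mat_trace H = 0" if "?P H" for H
  proof (cases "H = 0\<^sub>m m m")
    case True
    then show ?thesis by (simp add: mat_trace_def)
  qed (use that in blast)
  have "mat_trace X = mat_trace A + \<i> * mat_trace B"
    unfolding X_eq mat_trace_def using A B by (simp add: sum.distrib sum_distrib_left)
  then have "mat_trace X = 0"
    using tr[OF P(1)] tr[OF P(2)] by simp
  moreover have "A \<noteq> 0\<^sub>m m m \<or> B \<noteq> 0\<^sub>m m m"
    using norm_X X0 frob_norm_eq_0[OF A(1)] frob_norm_eq_0[OF B(1)] by auto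
  ultimately show "2 \<le> m \<and> mat_trace X = 0 \<and> (\<exists>H Q. unitary_mat m Q \<and>
         H * (mat_adjoint Q * diag_of m (\<lambda>i. if i < 2 then 0 else 1)) = 0\<^sub>m m m \<and>
         (\<forall>V\<in>carrier_mat m m. X * V = 0\<^sub>m m m \<longrightarrow> mat_adjoint X * V = 0\<^sub>m m m \<longrightarrow> H * V = 0\<^sub>m m m) \<and>
         (\<forall>V\<in>carrier_mat m m. H * V = 0\<^sub>m m m \<longrightarrow> Y * V = 0\<^sub>m m m \<and> mat_adjoint Y * V = 0\<^sub>m m m))"
    using P ker by metis
qed

section \<open>Two-by-two blocks padded by zeros\<close>

lemma diag_zero_carrier [simp]: "A \<in> carrier_mat 2 2 \<Longrightarrow> 2 \<le> m \<Longrightarrow> diag_zero m A \<in> carrier_mat m m"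
  by (auto simp: diag_zero_def Let_def)

lemma diag_zero_index:
  assumes "A \<in> carrier_mat 2 2" "2 \<le> m" "i < m" "j < m"
  shows "diag_zero m A $$ (i, j) = (if i < 2 \<and> j < 2 then A $$ (i, j) else 0)"
  using assms by (auto simp: diag_zero_def Let_def)

lemma sum_diag_zero:
  fixes f :: "nat \<Rightarrow> 'a::comm_monoid_add"
  assumes "2 \<le> m" "\<And>i. i < m \<Longrightarrow> 2 \<le> i \<Longrightarrow> f i = 0"
  shows "(\<Sum>i<m. f i) = (\<Sum>i<2. f i)"
  using assms by (intro sum.mono_neutral_right) auto

lemma frob_norm_diag_zero:
  fixes A :: "complex mat"
  assumes A: "A \<in> carrier_mat 2 2" and m: "2 \<le> m"
  shows "frob_norm (diag_zero m A) = frob_norm A"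
proof -
  let ?g = "\<lambda>i j. (norm (diag_zero m A $$ (i, j)))\<^sup>2"
  have "(\<Sum>i<m. \<Sum>j<m. ?g i j) = (\<Sum>i<2. \<Sum>j<m. ?g i j)"
    by (rule sum_diag_zero) (use m in \<open>auto simp: diag_zero_index[OF A m]\<close>)
  also have "\<dots> = (\<Sum>i<2. \<Sum>j<2. ?g i j)"
    by (intro sum.cong sum_diag_zero) (use m in \<open>auto simp: diag_zero_index[OF A m]\<close>)
  also have "\<dots> = (\<Sum>i<2. \<Sum>j<2. (norm (A $$ (i, j)))\<^sup>2)"
    using m by (intro sum.cong refl) (auto simp: diag_zero_index[OF A m])
  finally have "(frob_norm (diag_zero m A))\<^sup>2 = (frob_norm A)\<^sup>2"
    by (simp only: frob_norm_sq[OF A] frob_norm_sq[OF diag_zero_carrier[OF A m]])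
  then show ?thesis
    by (simp add: frob_norm_nonneg)
qed

lemma mat_trace_diag_zero:
  fixes A :: "complex mat"
  assumes A: "A \<in> carrier_mat 2 2" and m: "2 \<le> m"
  shows "mat_trace (diag_zero m A) = mat_trace A"
proof -
  have "mat_trace (diag_zero m A) = (\<Sum>i<m. diag_zero m A $$ (i, i))"
    using diag_zero_carrier[OF A m] by (auto simp: mat_trace_def)
  also have "\<dots> = (\<Sum>i<2. diag_zero m A $$ (i, i))"
    using m by (intro sum_diag_zero) (auto simp: diag_zero_index[OF A m])
  also have "\<dots> = mat_trace A"
    using A m by (auto simp: mat_trace_def diag_zero_index[OF A m])
  finally show ?thesis .
qed

lemma commutator_diag_zero:
  fixes A B :: "complex mat"
  assumes A: "A \<in> carrier_mat 2 2" and B: "B \<in> carrier_mat 2 2" and m: "2 \<le> m"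
  shows "commutator (diag_zero m A) (diag_zero m B) = diag_zero m (commutator A B)"
proof -
  have mult: "diag_zero m C * diag_zero m D = diag_zero m (C * D)"
    if C: "C \<in> carrier_mat 2 2" and D: "D \<in> carrier_mat 2 2" for C D :: "complex mat"
    using C D unfolding diag_zero_def Let_def
    by (subst mult_four_block_mat[of _ 2 2 _ "m - 2" _ "m - 2" _ _ 2 _ "m - 2"]) auto
  have "commutator (diag_zero m A) (diag_zero m B) = diag_zero m (A * B) - diag_zero m (B * A)"
    by (simp add: commutator_def mult A B)
  also have "\<dots> = diag_zero m (A * B - B * A)"
    using A B unfolding diag_zero_def Let_def by (intro eq_matI) auto
  finally show ?thesis
    by (simp add: commutator_def)
qed

text \<open>Twice the Lagrange identity \<open>|u x v|^2 = |u|^2 |v|^2 - |<u,v>|^2\<close> for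
  \<open>u = (sqrt 2 a, b, c)\<close> and \<open>v = (sqrt 2 p, q, r)\<close>.\<close>

lemma cross_product_identity:
  fixes a b c p q r :: complex
  shows "2 * (cmod (b * r - q * c))\<^sup>2 + 4 * (cmod (a * q - b * p))\<^sup>2 + 4 * (cmod (c * p - a * r))\<^sup>2
    = 2 * (2 * (cmod a)\<^sup>2 + (cmod b)\<^sup>2 + (cmod c)\<^sup>2) * (2 * (cmod p)\<^sup>2 + (cmod q)\<^sup>2 + (cmod r)\<^sup>2)
      - 2 * (cmod (2 * (a * cnj p) + b * cnj q + c * cnj r))\<^sup>2"
  unfolding cmod_power2 by (simp add: power2_eq_square algebra_simps)

text \<open>A traceless block is determined by three entries, and the commutator is their cross
  product up to constants. For traceless blocks equality in the bound thus means orthogonality,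
  which serves both directions of the theorem.\<close>

lemma frob_norm_commutator_traceless:
  fixes A B :: "complex mat"
  assumes A: "A \<in> carrier_mat 2 2" "mat_trace A = 0" and B: "B \<in> carrier_mat 2 2" "mat_trace B = 0"
  shows "(frob_norm (commutator A B))\<^sup>2 =
    2 * (frob_norm A)\<^sup>2 * (frob_norm B)\<^sup>2 - 2 * (cmod (mat_inner A B))\<^sup>2"
proof -
  define a b c p q r where "a = A $$ (0, 0)" and "b = A $$ (0, 1)" and "c = A $$ (1, 0)"
    and "p = B $$ (0, 0)" and "q = B $$ (0, 1)" and "r = B $$ (1, 0)"
  note abc = this
  have two: "{..<2} = {0, 1 :: nat}"
    by auto
  have d: "A $$ (1, 1) = - a" "B $$ (1, 1) = - p"
    using A B by (auto simp: mat_trace_def two abc eq_neg_iff_add_eq_0 add.commute)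
  have C: "commutator A B \<in> carrier_mat 2 2"
    using A B by (auto simp: commutator_def)
  have AB: "(A * B) $$ (i, j) = A $$ (i, 0) * B $$ (0, j) + A $$ (i, 1) * B $$ (1, j)"
    "(B * A) $$ (i, j) = B $$ (i, 0) * A $$ (0, j) + B $$ (i, 1) * A $$ (1, j)" if "i < 2" "j < 2" for i j
    using mat_mult_index[OF A(1) B(1) that] mat_mult_index[OF B(1) A(1) that] by (auto simp: two)
  have C_index: "commutator A B $$ (i, j) = (A * B) $$ (i, j) - (B * A) $$ (i, j)" if "i < 2" "j < 2" for i j
    using A B that by (simp add: commutator_def)
  have C_entries: "commutator A B $$ (0, 0) = b * r - q * c" "commutator A B $$ (0, 1) = 2 * (a * q - b * p)"
    "commutator A B $$ (1, 0) = 2 * (c * p - a * r)" "commutator A B $$ (1, 1) = - (b * r - q * c)"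
    by (simp_all add: C_index AB d algebra_simps del: One_nat_def index_mult_mat(1) flip: abc)
  have "(frob_norm (commutator A B))\<^sup>2 = (cmod (commutator A B $$ (0, 0)))\<^sup>2 + (cmod (commutator A B $$ (0, 1)))\<^sup>2
      + (cmod (commutator A B $$ (1, 0)))\<^sup>2 + (cmod (commutator A B $$ (1, 1)))\<^sup>2"
    by (simp add: frob_norm_sq[OF C] two del: One_nat_def)
  also have "\<dots> = 2 * (cmod (b * r - q * c))\<^sup>2 + 4 * (cmod (a * q - b * p))\<^sup>2 + 4 * (cmod (c * p - a * r))\<^sup>2"
    by (simp only: C_entries norm_minus_cancel norm_mult power_mult_distrib) simp
  finally have "(frob_norm (commutator A B))\<^sup>2 =
      2 * (cmod (b * r - q * c))\<^sup>2 + 4 * (cmod (a * q - b * p))\<^sup>2 + 4 * (cmod (c * p - a * r))\<^sup>2" .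
  moreover have "(frob_norm A)\<^sup>2 = 2 * (cmod a)\<^sup>2 + (cmod b)\<^sup>2 + (cmod c)\<^sup>2"
    "(frob_norm B)\<^sup>2 = 2 * (cmod p)\<^sup>2 + (cmod q)\<^sup>2 + (cmod r)\<^sup>2"
    using d by (simp_all add: frob_norm_sq[OF A(1)] frob_norm_sq[OF B(1)] two del: One_nat_def flip: abc)
  moreover have "mat_inner A B = 2 * (a * cnj p) + b * cnj q + c * cnj r"
    using d by (simp add: mat_inner_sum[OF A(1) B(1)] two del: One_nat_def flip: abc)
  ultimately show ?thesis
    using cross_product_identity[of b r q c a p] by simp
qed

lemma unitary_conj_commutator:
  assumes U: "unitary_mat m U" and M: "M \<in> carrier_mat m m" and N: "N \<in> carrier_mat m m"
  shows "commutator (U * M * mat_adjoint U) (U * N * mat_adjoint U) = U * commutator M N * mat_adjoint U"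
  using unitary_matD[OF U] M N
  unfolding commutator_def unitary_conj_mult[OF U M N, symmetric] unitary_conj_mult[OF U N M, symmetric]
  by (simp add: mult_minus_distrib_mat[where nr = m and n = m and nc = m]
      minus_mult_distrib_mat[where nr = m and n = m and nc = m])

lemma block_form_invariants:
  assumes U: "unitary_mat m U" and m: "2 \<le> m"
    and A: "A \<in> carrier_mat 2 2" and B: "B \<in> carrier_mat 2 2"
    and X: "X = mat_adjoint U * diag_zero m A * U" and Y: "Y = mat_adjoint U * diag_zero m B * U"
  shows "frob_norm X = frob_norm A" "mat_trace X = mat_trace A"
    "frob_norm (commutator X Y) = frob_norm (commutator A B)"
proof -
  note U' = unitary_mat_adjoint[OF U]
  note dA = diag_zero_carrier[OF A m] and dB = diag_zero_carrier[OF B m]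
  have C: "commutator A B \<in> carrier_mat 2 2"
    using A B by (simp add: commutator_def)
  show "frob_norm X = frob_norm A"
    using frob_norm_unitary_conj[OF U' dA] by (simp only: X mat_adjoint_adjoint frob_norm_diag_zero[OF A m])
  show "mat_trace X = mat_trace A"
    using mat_trace_unitary_conj[OF U' dA] by (simp only: X mat_adjoint_adjoint mat_trace_diag_zero[OF A m])
  show "frob_norm (commutator X Y) = frob_norm (commutator A B)"
    using unitary_conj_commutator[OF U' dA dB] frob_norm_unitary_conj[OF U' diag_zero_carrier[OF C m]]
    by (simp only: X Y mat_adjoint_adjoint commutator_diag_zero[OF A B m] frob_norm_diag_zero[OF C m])
qed

text \<open>In the basis given by U, killing the vectors from index 2 on clears the columns of M,
  and the same for the adjoint clears its rows.\<close>

lemma block_form_exists: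
  assumes U: "unitary_mat m U" and m: "2 \<le> m" and M: "M \<in> carrier_mat m m"
    and kill: "M * (mat_adjoint U * diag_of m (\<lambda>i. if i < 2 then 0 else 1)) = 0\<^sub>m m m"
      "mat_adjoint M * (mat_adjoint U * diag_of m (\<lambda>i. if i < 2 then 0 else 1)) = 0\<^sub>m m m"
  shows "\<exists>A\<in>carrier_mat 2 2. M = mat_adjoint U * diag_zero m A * U"
proof -
  note u = unitary_matD[OF U]
  note assoc = assoc_mult_mat[where n\<^sub>1 = m and n\<^sub>2 = m and n\<^sub>3 = m and n\<^sub>4 = m]
  let ?E = "diag_of m (\<lambda>i. if i < 2 then 0 else 1) :: complex mat"
  define Z where "Z = U * M * mat_adjoint U"
  have Z: "Z \<in> carrier_mat m m"
    using u(1,2) M by (simp add: Z_def)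
  have adj: "mat_adjoint Z = U * mat_adjoint M * mat_adjoint U"
    using u(1,2) M by (simp add: Z_def mat_adjoint_mult[where n = m and k = m and m = m] assoc)
  have E0: "(U * N * mat_adjoint U) $$ (i, j) = 0"
    if N: "N \<in> carrier_mat m m" and N0: "N * (mat_adjoint U * ?E) = 0\<^sub>m m m" and ij: "i < m" "j < m" "2 \<le> j" for N i j
  proof -
    have c: "U * N * mat_adjoint U \<in> carrier_mat m m"
      using u(1,2) N by simp
    have "U * N * mat_adjoint U * ?E = U * (N * (mat_adjoint U * ?E))"
      using u(1,2) N by (simp add: assoc)
    also have "\<dots> = 0\<^sub>m m m"
      unfolding N0 using u(1) by simp
    finally show ?thesis
      using diag_of_mult_index(2)[OF c ij(1,2), of "\<lambda>i. if i < 2 then 0 else 1"] ij by simp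
  qed
  have Z0: "Z $$ (i, j) = 0" if "i < m" "j < m" "2 \<le> i \<or> 2 \<le> j" for i j
  proof -
    have "2 \<le> j \<Longrightarrow> Z $$ (i, j) = 0"
      unfolding Z_def using M kill(1) that by (intro E0) auto
    moreover have "2 \<le> i \<Longrightarrow> mat_adjoint Z $$ (j, i) = 0"
      unfolding adj using M kill(2) that by (intro E0) auto
    ultimately show ?thesis
      using Z that by auto
  qed
  define A where "A = mat 2 2 (\<lambda>(i, j). Z $$ (i, j))"
  have A: "A \<in> carrier_mat 2 2"
    by (simp add: A_def)
  have A_index: "A $$ (i, j) = Z $$ (i, j)" if "i < 2" "j < 2" for i j
    using that by (simp add: A_def)
  have "Z = diag_zero m A"
    using Z diag_zero_carrier[OF A m]
    by (intro eq_matI) (auto simp: diag_zero_index[OF A m] A_index Z0)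
  then have "M = mat_adjoint U * diag_zero m A * U"
    using unitary_conj_eq[OF U M] by (simp only: Z_def)
  then show ?thesis
    using A by blast
qed

text \<open>Equality is symmetric in X and Y, so the kernel inclusions hold in both orders: vectors
  killed by H are killed by Y and Y*, hence by G, a hermitian part of Y, hence by X and X*. One
  basis, taken from H, therefore compresses both matrices.\<close>

lemma boettcher_wenzel_equality:
  fixes X Y :: "complex mat"
  assumes X: "X \<in> carrier_mat m m" and Y: "Y \<in> carrier_mat m m"
    and eq: "(frob_norm (commutator X Y))\<^sup>2 = 2 * (frob_norm X)\<^sup>2 * (frob_norm Y)\<^sup>2"
    and X0: "frob_norm X \<noteq> 0" and Y0: "frob_norm Y \<noteq> 0"
  obtains U A B where "unitary_mat m U" "2 \<le> m" "A \<in> carrier_mat 2 2" "B \<in> carrier_mat 2 2"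
    "X = mat_adjoint U * diag_zero m A * U" "Y = mat_adjoint U * diag_zero m B * U"
    "mat_inner A B = 0" "mat_trace A = 0" "mat_trace B = 0"
proof -
  have "commutator Y X = - commutator X Y"
    using X Y unfolding commutator_def by (intro eq_matI) auto
  moreover have "frob_norm (- M) = frob_norm M" for M :: "complex mat"
    by (simp add: frob_norm_def)
  ultimately have "frob_norm (commutator Y X) = frob_norm (commutator X Y)"
    by simp
  then have eq': "(frob_norm (commutator Y X))\<^sup>2 = 2 * (frob_norm Y)\<^sup>2 * (frob_norm X)\<^sup>2"
    using eq by simp
  obtain H U where m: "2 \<le> m" and trX: "mat_trace X = 0" and U: "unitary_mat m U"
    and HE: "H * (mat_adjoint U * diag_of m (\<lambda>i. if i < 2 then 0 else 1)) = 0\<^sub>m m m"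
    and HY: "\<And>V. V \<in> carrier_mat m m \<Longrightarrow> H * V = 0\<^sub>m m m \<Longrightarrow> Y * V = 0\<^sub>m m m \<and> mat_adjoint Y * V = 0\<^sub>m m m"
    using boettcher_wenzel(2)[OF X Y eq X0 Y0] by blast
  obtain G where trY: "mat_trace Y = 0"
    and YG: "\<And>V. V \<in> carrier_mat m m \<Longrightarrow> Y * V = 0\<^sub>m m m \<Longrightarrow> mat_adjoint Y * V = 0\<^sub>m m m \<Longrightarrow> G * V = 0\<^sub>m m m"
    and GX: "\<And>V. V \<in> carrier_mat m m \<Longrightarrow> G * V = 0\<^sub>m m m \<Longrightarrow> X * V = 0\<^sub>m m m \<and> mat_adjoint X * V = 0\<^sub>m m m"
    using boettcher_wenzel(2)[OF Y X eq' Y0 X0] by blast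
  define V where "V = mat_adjoint U * diag_of m (\<lambda>i. if i < 2 then 0 else 1)"
  have V: "V \<in> carrier_mat m m"
    using unitary_matD(2)[OF U] by (simp add: V_def)
  have YV: "Y * V = 0\<^sub>m m m" "mat_adjoint Y * V = 0\<^sub>m m m"
    using HY[OF V] HE by (simp_all add: V_def)
  have XV: "X * V = 0\<^sub>m m m" "mat_adjoint X * V = 0\<^sub>m m m"
    using GX[OF V] YG[OF V] YV by simp_all
  obtain A where A: "A \<in> carrier_mat 2 2" and X_eq: "X = mat_adjoint U * diag_zero m A * U"
    using block_form_exists[OF U m X] XV unfolding V_def by blast
  obtain B where B: "B \<in> carrier_mat 2 2" and Y_eq: "Y = mat_adjoint U * diag_zero m B * U"
    using block_form_exists[OF U m Y] YV unfolding V_def by blast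
  note XA = block_form_invariants[OF U m A B X_eq Y_eq] and YB = block_form_invariants[OF U m B A Y_eq X_eq]
  have tr: "mat_trace A = 0" "mat_trace B = 0"
    using XA(2) YB(2) trX trY by simp_all
  \<comment> \<open>Passing to the blocks preserves the three norms, so equality forces the
    correction term of the traceless identity to vanish.\<close>
  have "mat_inner A B = 0"
    using frob_norm_commutator_traceless[OF A tr(1) B tr(2)] eq unfolding XA YB(1) by simp
  then show ?thesis
    using that U m A B X_eq Y_eq tr by blast
qed

section \<open>Minors of a matrix with a singular block\<close>

lemma det_two:
  fixes A :: "'a::comm_ring_1 mat"
  assumes A: "A \<in> carrier_mat 2 2"
  shows "det A = A $$ (0, 0) * A $$ (1, 1) - A $$ (0, 1) * A $$ (1, 0)"
proof -
  have c: "mat_delete A i 0 \<in> carrier_mat 1 1" if "i < 2" for i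
    using A that by (auto simp: mat_delete_def)
  have d: "mat_delete A 0 0 $$ (0, 0) = A $$ (1, 1)" "mat_delete A 1 0 $$ (0, 0) = A $$ (0, 1)"
    using A by (auto simp: mat_delete_def)
  have "det A = (\<Sum>i<2. A $$ (i, 0) * cofactor A i 0)"
    using laplace_expansion_column[OF A, of 0] by simp
  also have "\<dots> = A $$ (0, 0) * cofactor A 0 0 + A $$ (1, 0) * cofactor A 1 0"
    by (simp add: numeral_2_eq_2)
  also have "\<dots> = A $$ (0, 0) * A $$ (1, 1) - A $$ (1, 0) * A $$ (0, 1)"
    using det_single[OF c[of 0]] det_single[OF c[of 1]] unfolding d by (simp add: cofactor_def)
  finally show ?thesis
    by (simp add: mult.commute)
qed

text \<open>Cauchy-Binet: a two-by-two minor of P is \<open>det A\<close> times a minor of the first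
  two columns of U* times a minor of the first two rows of U.\<close>

lemma singular_block_minor:
  fixes U A :: "complex mat"
  assumes U: "U \<in> carrier_mat m m" and m: "2 \<le> m" and A: "A \<in> carrier_mat 2 2"
    and det: "det A = 0" and P: "P = mat_adjoint U * diag_zero m A * U"
    and less: "k < m" "k' < m" "l < m" "l' < m"
  shows "P $$ (k, l) * P $$ (k', l') = P $$ (k, l') * P $$ (k', l)"
proof -
  have two: "{..<2} = {0, 1 :: nat}"
    by auto
  note dA = diag_zero_carrier[OF A m]
  have P_index: "P $$ (i, j) =
      cnj (U $$ (0, i)) * (A $$ (0, 0) * U $$ (0, j) + A $$ (0, 1) * U $$ (1, j))
      + cnj (U $$ (1, i)) * (A $$ (1, 0) * U $$ (0, j) + A $$ (1, 1) * U $$ (1, j))"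
    if "i < m" "j < m" for i j
  proof -
    have dU: "(diag_zero m A * U) $$ (h, j) = (\<Sum>l<2. diag_zero m A $$ (h, l) * U $$ (l, j))" if "h < m" for h
      unfolding mat_mult_index[OF dA U that \<open>j < m\<close>]
      using m that by (intro sum_diag_zero) (auto simp: diag_zero_index[OF A m])
    have "P $$ (i, j) = (\<Sum>h<m. mat_adjoint U $$ (i, h) * (diag_zero m A * U) $$ (h, j))"
      unfolding P assoc_mult_mat[OF mat_adjoint_carrier[OF U] dA U]
      using U dA that by (intro mat_mult_index) auto
    also have "\<dots> = (\<Sum>h<m. cnj (U $$ (h, i)) * (\<Sum>l<2. diag_zero m A $$ (h, l) * U $$ (l, j)))"
      using U that by (intro sum.cong refl) (auto simp: dU simp del: index_mult_mat(1))
    also have "\<dots> = (\<Sum>h<2. cnj (U $$ (h, i)) * (\<Sum>l<2. diag_zero m A $$ (h, l) * U $$ (l, j)))"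
      using m by (intro sum_diag_zero) (auto simp: diag_zero_index[OF A m])
    finally show ?thesis
      using m by (simp add: two diag_zero_index[OF A m])
  qed
  have "A $$ (0, 0) * A $$ (1, 1) = A $$ (0, 1) * A $$ (1, 0)"
    using det by (simp add: det_two[OF A])
  moreover have "(x * (a * u + b * v) + y * (c * u + d * v)) * (x' * (a * u' + b * v') + y' * (c * u' + d * v')) =
      (x * (a * u' + b * v') + y * (c * u' + d * v')) * (x' * (a * u + b * v) + y' * (c * u + d * v))"
    if "a * d = b * c" for a b c d x y u v x' y' u' v' :: complex
  proof -
    \<comment> \<open>The three factors on the right are the determinant of the block and the minors
      of U* and of U.\<close>
    have "(x * (a * u + b * v) + y * (c * u + d * v)) * (x' * (a * u' + b * v') + y' * (c * u' + d * v'))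
      - (x * (a * u' + b * v') + y * (c * u' + d * v')) * (x' * (a * u + b * v) + y' * (c * u + d * v))
      = (a * d - b * c) * (x * y' - y * x') * (u * v' - v * u')"
      by (simp add: algebra_simps)
    then show ?thesis
      using that by simp
  qed
  ultimately show ?thesis
    unfolding P_index[OF less(1,3)] P_index[OF less(2,4)] P_index[OF less(1,4)] P_index[OF less(2,3)]
    by blast
qed

section \<open>Quaternionic matrices\<close>

text \<open>The conjugates in the product rules come from moving j past a complex number,
  \<open>j z = cnj z j\<close>, together with \<open>j j = -1\<close>.\<close>

lemma cpart_simps:
  "cpart1 0 = 0" "cpart2 0 = 0"
  "cpart1 (p + q) = cpart1 p + cpart1 q" "cpart2 (p + q) = cpart2 p + cpart2 q"
  "cpart1 (p - q) = cpart1 p - cpart1 q" "cpart2 (p - q) = cpart2 p - cpart2 q"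
  "cpart1 (p * q) = cpart1 p * cpart1 q - cpart2 p * cnj (cpart2 q)"
  "cpart2 (p * q) = cpart1 p * cpart2 q + cpart2 p * cnj (cpart1 q)"
  by (simp_all add: cpart1_def cpart2_def complex_eq_iff times_quat_def)

lemma cpart_sum:
  "cpart1 (\<Sum>i\<in>I. f i) = (\<Sum>i\<in>I. cpart1 (f i))" "cpart2 (\<Sum>i\<in>I. f i) = (\<Sum>i\<in>I. cpart2 (f i))"
  by (induction I rule: infinite_finite_induct) (simp_all add: cpart_simps)

lemma norm_quat_cpart: "(norm q)\<^sup>2 = (cmod (cpart1 q))\<^sup>2 + (cmod (cpart2 q))\<^sup>2"
  by (simp add: norm_quat_def cpart1_def cpart2_def cmod_def)

lemma Psi_carrier [simp]: "X \<in> carrier_mat n n \<Longrightarrow> Psi X \<in> carrier_mat (2 * n) (2 * n)"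
  by (auto simp: Psi_def Let_def)

lemma Psi_index:
  assumes "X \<in> carrier_mat n n" "i < n" "j < n"
  shows "Psi X $$ (i, j) = cpart1 (X $$ (i, j))"
    "Psi X $$ (i, n + j) = cpart2 (X $$ (i, j))"
    "Psi X $$ (n + i, j) = - cnj (cpart2 (X $$ (i, j)))"
    "Psi X $$ (n + i, n + j) = cnj (cpart1 (X $$ (i, j)))"
  using assms by (auto simp: Psi_def Let_def)

lemma Psi_mult:
  assumes X: "X \<in> carrier_mat n n" and Y: "Y \<in> carrier_mat n n"
  shows "Psi (X * Y) = Psi X * Psi Y"
proof -
  note XY = X Y map_carrier_mat uminus_carrier_mat
  have "map_mat cpart1 (X * Y) = map_mat cpart1 X * map_mat cpart1 Y + map_mat cpart2 X * (- map_mat cnj (map_mat cpart2 Y))"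
    "map_mat cpart2 (X * Y) = map_mat cpart1 X * map_mat cpart2 Y + map_mat cpart2 X * map_mat cnj (map_mat cpart1 Y)"
    "- map_mat cnj (map_mat cpart2 (X * Y)) = - map_mat cnj (map_mat cpart2 X) * map_mat cpart1 Y
      + map_mat cnj (map_mat cpart1 X) * (- map_mat cnj (map_mat cpart2 Y))"
    "map_mat cnj (map_mat cpart1 (X * Y)) = - map_mat cnj (map_mat cpart2 X) * map_mat cpart2 Y
      + map_mat cnj (map_mat cpart1 X) * map_mat cnj (map_mat cpart1 Y)"
    using X Y
    by (auto intro!: eq_matI simp: scalar_prod_def cpart_sum cpart_simps sum.distrib sum_subtractf sum_negf)
  then show ?thesis
    using X Y unfolding Psi_def Let_def
    by (subst mult_four_block_mat[of _ n n _ n _ n _ _ n _ n]) auto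
qed

lemma Psi_minus:
  assumes X: "X \<in> carrier_mat n n" and Y: "Y \<in> carrier_mat n n"
  shows "Psi (X - Y) = Psi X - Psi Y"
  using X Y unfolding Psi_def Let_def by (intro eq_matI) (auto simp: cpart_simps)

lemma Psi_commutator:
  assumes "X \<in> carrier_mat n n" "Y \<in> carrier_mat n n"
  shows "Psi (commutator X Y) = commutator (Psi X) (Psi Y)"
  using assms by (simp add: commutator_def Psi_mult Psi_minus[where n = n])

lemma sum_lessThan_add:
  fixes f :: "nat \<Rightarrow> 'a::comm_monoid_add"
  shows "(\<Sum>i<n + k. f i) = (\<Sum>i<n. f i) + (\<Sum>i<k. f (n + i))"
  by (induction k) (simp_all add: add.assoc)

text \<open>Each quaternionic entry contributes its two complex coordinates twice, up to sign and
  conjugation.\<close>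

lemma frob_norm_Psi:
  assumes X: "X \<in> carrier_mat n n"
  shows "(frob_norm (Psi X))\<^sup>2 = 2 * (frob_norm X)\<^sup>2"
proof -
  have "(frob_norm (Psi X))\<^sup>2 = (\<Sum>i<n + n. \<Sum>j<n + n. (cmod (Psi X $$ (i, j)))\<^sup>2)"
    using frob_norm_sq[OF Psi_carrier[OF X]] by (simp add: mult_2)
  also have "\<dots> = (\<Sum>i<n. \<Sum>j<n. 2 * (norm (X $$ (i, j)))\<^sup>2)"
    unfolding sum_lessThan_add sum.distrib[symmetric]
    by (intro sum.cong refl) (simp add: Psi_index[OF X] norm_quat_cpart)
  finally show ?thesis
    by (simp add: frob_norm_sq[OF X] sum_distrib_left)
qed

text \<open>The minor of \<open>Psi X\<close> on rows i, n + i and columns j, n + j is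
  \<open>|x_ij|^2\<close>. A singular block would make all of these vanish.\<close>

lemma Psi_block_det:
  assumes X: "X \<in> carrier_mat n n" "frob_norm X \<noteq> 0" and U: "U \<in> carrier_mat (2 * n) (2 * n)"
    and n: "2 \<le> 2 * n" and A: "A \<in> carrier_mat 2 2" and P: "Psi X = mat_adjoint U * diag_zero (2 * n) A * U"
  shows "det A \<noteq> 0"
proof
  assume det: "det A = 0"
  have "X $$ (i, j) = 0" if "i < n" "j < n" for i j
  proof -
    have "Psi X $$ (i, j) * Psi X $$ (n + i, n + j) = Psi X $$ (i, n + j) * Psi X $$ (n + i, j)"
      by (rule singular_block_minor[OF U n A det P]) (use that in auto)
    then have "complex_of_real ((norm (X $$ (i, j)))\<^sup>2) = 0"
      unfolding Psi_index[OF X(1) that] norm_quat_cpart of_real_add complex_norm_square by simp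
    then show ?thesis
      by simp
  qed
  then have "X = 0\<^sub>m n n"
    using X by (intro eq_matI) auto
  then show False
    using X frob_norm_eq_0 by blast
qed

theorem theorem3p1:
  fixes X Y :: "quat mat" and n :: nat
  assumes "X \<in> carrier_mat n n" and "Y \<in> carrier_mat n n"
  shows "(frob_norm (commutator X Y))\<^sup>2 \<le> 4 * (frob_norm X)\<^sup>2 * (frob_norm Y)\<^sup>2
    \<and> ((frob_norm (commutator X Y))\<^sup>2 = 4 * (frob_norm X)\<^sup>2 * (frob_norm Y)\<^sup>2
       \<longleftrightarrow>
       frob_norm X * frob_norm Y = 0 \<or>
       (\<exists>U X0 Y0. unitary_mat (2 * n) U \<and>
          X0 \<in> carrier_mat 2 2 \<and> Y0 \<in> carrier_mat 2 2 \<and>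
          Psi X = mat_adjoint U * diag_zero (2 * n) X0 * U \<and>
          Psi Y = mat_adjoint U * diag_zero (2 * n) Y0 * U \<and>
          mat_inner X0 Y0 = 0 \<and>
          mat_trace X0 = 0 \<and> mat_trace Y0 = 0 \<and>
          vec_space.rank 2 X0 = 2 \<and> vec_space.rank 2 Y0 = 2))"
    (is "?le \<and> (?eq \<longleftrightarrow> _ \<or> ?ex)")
proof -
  note X = assms(1) and Y = assms(2)
  note PX = Psi_carrier[OF X] and PY = Psi_carrier[OF Y]
  have C: "commutator X Y \<in> carrier_mat n n"
    using X Y by (simp add: commutator_def)
  note nX = frob_norm_Psi[OF X] and nY = frob_norm_Psi[OF Y]
  have nC: "(frob_norm (commutator (Psi X) (Psi Y)))\<^sup>2 = 2 * (frob_norm (commutator X Y))\<^sup>2"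
    using frob_norm_Psi[OF C] by (simp add: Psi_commutator[OF X Y])
  have le: ?le
    using boettcher_wenzel(1)[OF PX PY] by (simp add: nX nY nC)
  \<comment> \<open>One doubling on the left and two on the right turn the complex constant 2 into
    the quaternionic constant 4.\<close>
  have eq_iff: "?eq \<longleftrightarrow> (frob_norm (commutator (Psi X) (Psi Y)))\<^sup>2 = 2 * (frob_norm (Psi X))\<^sup>2 * (frob_norm (Psi Y))\<^sup>2"
    by (simp add: nX nY nC mult.assoc)
  have "?eq \<Longrightarrow> frob_norm X * frob_norm Y \<noteq> 0 \<Longrightarrow> ?ex"
  proof -
    assume eq: ?eq and "frob_norm X * frob_norm Y \<noteq> 0"
    then have X0: "frob_norm X \<noteq> 0" and Y0: "frob_norm Y \<noteq> 0"
      by auto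
    have PX0: "frob_norm (Psi X) \<noteq> 0" and PY0: "frob_norm (Psi Y) \<noteq> 0"
      using nX nY X0 Y0 by auto
    from boettcher_wenzel_equality[OF PX PY eq[unfolded eq_iff] PX0 PY0]
    obtain U A B where U: "unitary_mat (2 * n) U" and n: "2 \<le> 2 * n"
      and A: "A \<in> carrier_mat 2 2" and B: "B \<in> carrier_mat 2 2"
      and X_eq: "Psi X = mat_adjoint U * diag_zero (2 * n) A * U"
      and Y_eq: "Psi Y = mat_adjoint U * diag_zero (2 * n) B * U"
      and AB: "mat_inner A B = 0" "mat_trace A = 0" "mat_trace B = 0" .
    have "det A \<noteq> 0" "det B \<noteq> 0"
      using Psi_block_det[OF X X0 unitary_matD(1)[OF U] n A X_eq]
        Psi_block_det[OF Y Y0 unitary_matD(1)[OF U] n B Y_eq] .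
    then have "vec_space.rank 2 A = 2" "vec_space.rank 2 B = 2"
      using vec_space.det_rank_iff A B by blast+
    then show ?ex
      using U A B X_eq Y_eq AB by blast
  qed
  moreover have "?eq" if "frob_norm X * frob_norm Y = 0"
  proof -
    have 0: "4 * (frob_norm X)\<^sup>2 * (frob_norm Y)\<^sup>2 = 0"
      using that by auto
    show ?thesis
      using le unfolding 0 by simp
  qed
  moreover have "?eq" if ex: ?ex and ne: "frob_norm X * frob_norm Y \<noteq> 0"
  proof -
    obtain U A B where U: "unitary_mat (2 * n) U" and A: "A \<in> carrier_mat 2 2" and B: "B \<in> carrier_mat 2 2"
      and X_eq: "Psi X = mat_adjoint U * diag_zero (2 * n) A * U"
      and Y_eq: "Psi Y = mat_adjoint U * diag_zero (2 * n) B * U"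
      and AB: "mat_inner A B = 0" "mat_trace A = 0" "mat_trace B = 0"
      using ex by blast
    \<comment> \<open>The two-by-two block fits into size 2n only for positive n; an empty X would
      have norm 0.\<close>
    have "n \<noteq> 0"
    proof
      assume "n = 0"
      then have "(frob_norm X)\<^sup>2 = 0"
        using frob_norm_sq[OF X] by simp
      then show False
        using ne by simp
    qed
    then have n: "2 \<le> 2 * n"
      by simp
    show ?thesis
      unfolding eq_iff block_form_invariants[OF U n A B X_eq Y_eq] block_form_invariants(1)[OF U n B A Y_eq X_eq]
      using frob_norm_commutator_traceless[OF A AB(2) B AB(3)] AB(1) by simp
  qed
  ultimately show ?thesis
    using le by blast
qed

end
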